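(* $B(8)=183$.
   Context: For $n\ge 2$, $B(n)$ (the one-sided kissing number) is the maximal cardinality of a finite set $C$ of unit vectors in $\mathbb{R}^n$ contained in a closed hemisphere $\{x\in\mathbb{R}^n: x\cdot x=1,\ e\cdot x\ge 0\}$ (where $e\in\mathbb{R}^n$ is a fixed unit vector) with pairwise angular distance at least $\pi/3$, i.e. $c\cdot c'\le 1/2$ for all distinct $c,c'\in C$. *)

theory Defs
  imports "HOL-Analysis.Analysis" "HOL-Library.Numeral_Type"
begin

definition closed_hemisphere :: "real ^ 'n \<Rightarrow> (real ^ 'n) set" where
  "closed_hemisphere e = {x. x \<bullet> x = 1 \<and> e \<bullet> x \<ge> 0}"

definition angular_distance :: "real ^ 'n \<Rightarrow> real ^ 'n \<Rightarrow> real" where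
  "angular_distance x y = arccos (x \<bullet> y)"

definition one_sided_kissing_configuration :: "real ^ 'n \<Rightarrow> (real ^ 'n) set \<Rightarrow> bool" where
  "one_sided_kissing_configuration e C \<longleftrightarrow>
     finite C \<and> C \<subseteq> closed_hemisphere e \<and>
     (\<forall>c\<in>C. \<forall>c'\<in>C. c \<noteq> c' \<longrightarrow> angular_distance c c' \<ge> pi / 3)"

text \<open>The number $B(n)$, for $n$ the cardinality of the index type. The pole \<open>e\<close> of the
  hemisphere is an argument; the lemmas below show that \<open>Max\<close> is taken over a finite nonempty
  set and that its value is the same for all unit vectors \<open>e\<close>.\<close>

definition one_sided_kissing_number :: "real ^ 'n \<Rightarrow> nat" where
  "one_sided_kissing_number e = Max {card C |C. one_sided_kissing_configuration e C}"

lemma angular_distance_ge_pi_third_iff: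
  fixes x y :: "real ^ 'n"
  assumes "x \<bullet> x = 1" "y \<bullet> y = 1"
  shows "angular_distance x y \<ge> pi / 3 \<longleftrightarrow> x \<bullet> y \<le> 1 / 2"
proof -
  have "norm x = 1" "norm y = 1"
    using assms by (simp_all add: norm_eq_sqrt_inner)
  then have "\<bar>x \<bullet> y\<bar> \<le> 1"
    using Cauchy_Schwarz_ineq2[of x y] by simp
  moreover have "arccos (1 / 2) = pi / 3"
    using arccos_cos[of "pi / 3"] by (simp add: cos_60)
  ultimately show ?thesis
    unfolding angular_distance_def using arccos_le_mono[of "1 / 2" "x \<bullet> y"] by simp
qed

lemma one_sided_kissing_configuration_iff:
  fixes e :: "real ^ 'n"
  shows "one_sided_kissing_configuration e C \<longleftrightarrow>
    finite C \<and> (\<forall>c\<in>C. c \<bullet> c = 1 \<and> e \<bullet> c \<ge> 0) \<and>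
    (\<forall>c\<in>C. \<forall>c'\<in>C. c \<noteq> c' \<longrightarrow> c \<bullet> c' \<le> 1 / 2)"
proof (cases "\<forall>c\<in>C. c \<bullet> c = 1 \<and> e \<bullet> c \<ge> 0")
  case True
  then have "angular_distance c c' \<ge> pi / 3 \<longleftrightarrow> c \<bullet> c' \<le> 1 / 2" if "c \<in> C" "c' \<in> C" for c c'
    using that by (intro angular_distance_ge_pi_third_iff) auto
  moreover have "C \<subseteq> closed_hemisphere e"
    using True by (auto simp: closed_hemisphere_def)
  ultimately show ?thesis
    using True unfolding one_sided_kissing_configuration_def by metis
next
  case False
  then show ?thesis
    unfolding one_sided_kissing_configuration_def closed_hemisphere_def by auto
qed

lemma finite_one_sided_kissing_cards:
  fixes e :: "real ^ 'n"
  shows "finite {card C |C. one_sided_kissing_configuration e C}"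
proof -
  obtain K :: "(real ^ 'n) set" where K: "finite K" "sphere 0 1 \<subseteq> (\<Union>k\<in>K. ball k (1 / 2))"
    using seq_compact_imp_totally_bounded[of "sphere (0 :: real ^ 'n) 1"]
      compact_imp_seq_compact[OF compact_sphere]
    by (metis half_gt_zero_iff zero_less_one)
  have "card C \<le> card K" if C: "one_sided_kissing_configuration e C" for C
  proof -
    have unit: "c \<bullet> c = 1" if "c \<in> C" for c
      using C that by (simp add: one_sided_kissing_configuration_iff)
    then have "\<forall>c\<in>C. \<exists>k\<in>K. c \<in> ball k (1 / 2)"
      using K(2) by (force simp: norm_eq_sqrt_inner)
    then obtain f where f: "\<And>c. c \<in> C \<Longrightarrow> f c \<in> K \<and> dist (f c) c < 1 / 2"
      by (metis mem_ball)
    have "inj_on f C"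
    proof (rule inj_onI, rule ccontr)
      fix c c' assume c: "c \<in> C" "c' \<in> C" "f c = f c'" "c \<noteq> c'"
      have "dist c c' < 1"
        using f[OF c(1)] f[OF c(2)] c(3) dist_triangle_half_r[of "f c" c 1 c'] by simp
      then have "(norm (c - c'))\<^sup>2 < 1"
        by (simp add: dist_norm abs_square_less_1)
      moreover have "(norm (c - c'))\<^sup>2 = 2 - 2 * (c \<bullet> c')"
        using unit c(1,2)
        by (simp add: power2_norm_eq_inner inner_diff_left inner_diff_right inner_commute)
      moreover have "c \<bullet> c' \<le> 1 / 2"
        using C c by (simp add: one_sided_kissing_configuration_iff)
      ultimately show False by simp
    qed
    then show ?thesis
      using f K(1) by (intro card_inj_on_le[of f]) auto
  qed
  then have "{card C |C. one_sided_kissing_configuration e C} \<subseteq> {..card K}" by auto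
  then show ?thesis by (rule finite_subset) simp
qed

lemma one_sided_kissing_cards_nonempty:
  fixes e :: "real ^ 'n"
  shows "{card C |C. one_sided_kissing_configuration e C} \<noteq> {}"
  by (auto simp: one_sided_kissing_configuration_iff intro!: exI[of _ "{}"])

lemma one_sided_kissing_number_cong:
  fixes e e' :: "real ^ 'n"
  assumes "norm e = 1" "norm e' = 1"
  shows "one_sided_kissing_number e = one_sided_kissing_number e'"
proof -
  have sub: "{card C |C. one_sided_kissing_configuration a C}
      \<subseteq> {card C |C. one_sided_kissing_configuration b C}"
    if "norm a = 1" "norm b = 1" for a b :: "real ^ 'n"
  proof -
    obtain f where f: "orthogonal_transformation f" "f a = b"
      using orthogonal_transformation_exists[of a b] \<open>norm a = 1\<close> \<open>norm b = 1\<close> by metis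
    have inner: "f v \<bullet> f w = v \<bullet> w" for v w
      using f(1) by (simp add: orthogonal_transformation_def)
    have "inj f"
      using f(1) by (rule orthogonal_transformation_inj)
    then have card: "card (f ` C) = card C" for C
      by (meson card_image inj_on_subset subset_UNIV)
    have "one_sided_kissing_configuration b (f ` C)" if "one_sided_kissing_configuration a C" for C
      using that inner inner[of a] f(2) unfolding one_sided_kissing_configuration_iff by auto
    then show ?thesis
      using card by (smt (verit) Collect_mono)
  qed
  then have "{card C |C. one_sided_kissing_configuration e C}
      = {card C |C. one_sided_kissing_configuration e' C}"
    using assms by (intro subset_antisym) auto
  then show ?thesis by (simp add: one_sided_kissing_number_def)
qed

end

theory Submission
  imports Defs
begin

text \<open>Why the number is \<open>183\<close>. The \<open>240\<close> roots of \<open>E\<^sub>8\<close>, normalized, have pairwise inner products at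
most \<open>1/2\<close>. With a root as pole, the closed hemisphere contains the pole, the \<open>56\<close> roots at angle
\<open>\<pi>/3\<close> and the \<open>126\<close> orthogonal ones (\<open>half_root_configuration\<close>).

The upper bound follows the semidefinite programming method of Bachoc and Vallentin. Let
\<open>u = e \<bullet> x\<close>, \<open>v = e \<bullet> y\<close>, \<open>t = x \<bullet> y\<close>. Suppose that a polynomial \<open>K(u, v, t)\<close> is a positive
definite kernel on the sphere, that \<open>K \<le> -1\<close> for distinct points of an admissible configuration,
and that \<open>K(u, u, 1) \<le> M - 1\<close> for \<open>0 \<le> u \<le> 1\<close>. Summing \<open>K\<close> over all pairs of the \<open>N\<close> points
gives \<open>0 \<le> N (M - 1) - N (N - 1)\<close>, so \<open>N \<le> M\<close>. Since \<open>N\<close> is an integer, any \<open>M < 184\<close> is good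
enough; here \<open>M = 183.5\<close>, and the room left absorbs rounding errors.

Positive definite kernels are obtained as follows. The inner product of the projections of \<open>x\<close> and
\<open>y\<close> to the equatorial hyperplane is \<open>t - u v\<close>, and their squared lengths are \<open>1 - u\<^sup>2\<close> and
\<open>1 - v\<^sup>2\<close>. Homogeneous Gegenbauer polynomials of these quantities, for dimension \<open>7\<close>, are positive
definite (\<open>gegen_positive_definite\<close>), and remain so after multiplication by sums of
\<open>p(u) p(v)\<close>. Positive definiteness is proved with the Fischer inner product
\<open>p(\<partial>) q\<close> on polynomials, for which harmonic polynomials are orthogonal to multiples of \<open>|z|\<^sup>2\<close>.

The two inequalities for \<open>K\<close> are certified by sums of squares. Off the diagonal,
\<open>K + 1 + \<sigma>\<^sub>0 + u(1 - u) \<sigma>\<^sub>1(u, v, t) + v(1 - v) \<sigma>\<^sub>1(v, u, t) + (1 + t)(1/2 - t) \<sigma>\<^sub>2\<close> is a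
polynomial with tiny coefficients, where each \<open>\<sigma>\<^sub>i\<close> is a sum of squares; on the
diagonal, \<open>K(u, u, 1) - (M - 1) + \<tau>\<^sub>0 + u(1 - u) \<tau>\<^sub>1\<close> is one. As the squares are given explicitly by
integer vectors, their positivity needs no proof. What is left is to expand the polynomials and to
add up the absolute values of the resulting coefficients (\<open>kernel_off_diagonal\<close>, \<open>kernel_diagonal\<close>).\<close>

section \<open>Polynomials and the Fischer inner product\<close>

text \<open>A polynomial in variables indexed by \<open>'n\<close> is its family of coefficients. Only operators on
coefficients are used below, so finite support is never imposed; \<open>fischer k\<close> looks at the
coefficients of degree \<open>k\<close> alone.\<close>

type_synonym 'n coeffs = "('n \<Rightarrow> nat) \<Rightarrow> real"

definition mulv :: "'n \<Rightarrow> 'n coeffs \<Rightarrow> 'n coeffs" where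
  "mulv i p = (\<lambda>\<alpha>. if \<alpha> i = 0 then 0 else p (\<alpha>(i := \<alpha> i - 1)))"

definition der :: "'n \<Rightarrow> 'n coeffs \<Rightarrow> 'n coeffs" where
  "der i p = (\<lambda>\<alpha>. (real (\<alpha> i) + 1) * p (\<alpha>(i := Suc (\<alpha> i))))"

definition unit_poly :: "'n coeffs" where
  "unit_poly = (\<lambda>\<alpha>. if \<alpha> = (\<lambda>_. 0) then 1 else 0)"

definition mul_lin :: "real ^ 'n \<Rightarrow> 'n::finite coeffs \<Rightarrow> 'n coeffs" where
  "mul_lin y p = (\<lambda>\<alpha>. \<Sum>i\<in>UNIV. y $ i * mulv i p \<alpha>)"

definition der_dir :: "real ^ 'n \<Rightarrow> 'n::finite coeffs \<Rightarrow> 'n coeffs" where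
  "der_dir y p = (\<lambda>\<alpha>. \<Sum>i\<in>UNIV. y $ i * der i p \<alpha>)"

definition mul_sq :: "'n::finite coeffs \<Rightarrow> 'n coeffs" where
  "mul_sq p = (\<lambda>\<alpha>. \<Sum>i\<in>UNIV. mulv i (mulv i p) \<alpha>)"

definition laplacian :: "'n::finite coeffs \<Rightarrow> 'n coeffs" where
  "laplacian p = (\<lambda>\<alpha>. \<Sum>i\<in>UNIV. der i (der i p) \<alpha>)"

text \<open>The weight \<open>\<alpha>!\<close> makes multiplication by a variable adjoint to differentiation in that variable.
This replaces integration over the sphere: harmonic polynomials become orthogonal to every
multiple of \<open>|z|\<^sup>2\<close> by pure algebra.\<close>

definition fischer :: "nat \<Rightarrow> 'n::finite coeffs \<Rightarrow> 'n coeffs \<Rightarrow> real" where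
  "fischer k p q = (\<Sum>\<alpha> | sum \<alpha> UNIV = k. (\<Prod>i\<in>UNIV. fact (\<alpha> i)) * p \<alpha> * q \<alpha>)"

lemma mulv_sum: "mulv i (\<lambda>\<alpha>. \<Sum>j\<in>J. f j \<alpha>) = (\<lambda>\<alpha>. \<Sum>j\<in>J. mulv i (f j) \<alpha>)"
  by (auto simp: mulv_def fun_eq_iff)

lemma der_sum: "der i (\<lambda>\<alpha>. \<Sum>j\<in>J. f j \<alpha>) = (\<lambda>\<alpha>. \<Sum>j\<in>J. der i (f j) \<alpha>)"
  by (auto simp: der_def fun_eq_iff sum_distrib_left)

lemma mulv_scale: "mulv i (\<lambda>\<alpha>. c * p \<alpha>) = (\<lambda>\<alpha>. c * mulv i p \<alpha>)"
  by (auto simp: mulv_def fun_eq_iff)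

lemma der_scale: "der i (\<lambda>\<alpha>. c * p \<alpha>) = (\<lambda>\<alpha>. c * der i p \<alpha>)"
  by (auto simp: der_def fun_eq_iff)

lemma der_add: "der i (\<lambda>\<alpha>. p \<alpha> + q \<alpha>) = (\<lambda>\<alpha>. der i p \<alpha> + der i q \<alpha>)"
  by (auto simp: der_def fun_eq_iff algebra_simps)

text \<open>The canonical commutation relation. Together with the adjointness relations it determines all
inner products that are needed below.\<close>

lemma der_mulv:
  "der i (mulv j p) = (\<lambda>\<alpha>. mulv j (der i p) \<alpha> + of_bool (i = j) * p \<alpha>)"
  by (cases "i = j") (auto simp: der_def mulv_def fun_eq_iff fun_upd_twist algebra_simps of_nat_diff)

lemma der_der_mulv:
  "der i (der i (mulv j p)) = (\<lambda>\<alpha>. mulv j (der i (der i p)) \<alpha> + of_bool (i = j) * (2 * der i p \<alpha>))"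
  by (simp add: der_mulv der_add der_scale fun_eq_iff)

lemma der_der_mulv_mulv:
  "der i (der i (mulv j (mulv j p))) = (\<lambda>\<alpha>. mulv j (mulv j (der i (der i p))) \<alpha>
     + of_bool (i = j) * (4 * mulv j (der i p) \<alpha> + 2 * p \<alpha>))"
proof -
  have add: "mulv j (\<lambda>\<alpha>. f \<alpha> + c * g \<alpha>) = (\<lambda>\<alpha>. mulv j f \<alpha> + c * mulv j g \<alpha>)" for f g c
    by (auto simp: mulv_def fun_eq_iff)
  show ?thesis
    unfolding der_der_mulv[of i j "mulv j p"]
    unfolding der_der_mulv[of i j p] add
    unfolding der_mulv[of i j p]
    by (cases "i = j") (simp_all add: mulv_scale fun_eq_iff)
qed

lemma mulv_der: "mulv i (der i p) \<alpha> = real (\<alpha> i) * p \<alpha>"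
  by (auto simp: mulv_def der_def of_nat_diff)

lemma laplacian_mul_lin:
  "laplacian (mul_lin y p) = (\<lambda>\<alpha>. mul_lin y (laplacian p) \<alpha> + 2 * der_dir y p \<alpha>)"
proof
  fix \<alpha>
  have "laplacian (mul_lin y p) \<alpha> = (\<Sum>i\<in>UNIV. \<Sum>j\<in>UNIV. y $ j * der i (der i (mulv j p)) \<alpha>)"
    unfolding laplacian_def mul_lin_def by (simp add: der_sum der_scale)
  also have "\<dots> = (\<Sum>i\<in>UNIV. \<Sum>j\<in>UNIV. y $ j * mulv j (der i (der i p)) \<alpha>)
      + (\<Sum>i\<in>UNIV. \<Sum>j\<in>UNIV. y $ j * (of_bool (i = j) * (2 * der i p \<alpha>)))"
    by (simp add: der_der_mulv distrib_left sum.distrib)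
  also have "(\<Sum>i\<in>UNIV. \<Sum>j\<in>UNIV. y $ j * mulv j (der i (der i p)) \<alpha>) = mul_lin y (laplacian p) \<alpha>"
    unfolding laplacian_def mul_lin_def by (subst sum.swap) (simp add: mulv_sum sum_distrib_left)
  also have "(\<Sum>i\<in>UNIV. \<Sum>j\<in>UNIV. y $ j * (of_bool (i = j) * (2 * der i p \<alpha>))) = 2 * der_dir y p \<alpha>"
    unfolding der_dir_def by (simp add: of_bool_def if_distrib if_distribR sum_distrib_left ac_simps cong: if_cong)
  finally show "laplacian (mul_lin y p) \<alpha> = mul_lin y (laplacian p) \<alpha> + 2 * der_dir y p \<alpha>" .
qed

text \<open>The dimension enters here, and only here: the commutator of the Laplacian with multiplication by
\<open>|z|\<^sup>2\<close> is \<open>2n + 4E\<close> with the Euler operator \<open>E\<close>, which acts on the coefficient of index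
\<open>\<alpha>\<close> as multiplication by the degree of \<open>\<alpha>\<close>.\<close>

lemma laplacian_mul_sq:
  fixes p :: "'n::finite coeffs"
  shows "laplacian (mul_sq p) \<alpha> =
    mul_sq (laplacian p) \<alpha> + (2 * CARD('n) + 4 * sum \<alpha> UNIV) * p \<alpha>"
proof -
  have "laplacian (mul_sq p) \<alpha> = (\<Sum>i\<in>UNIV. \<Sum>j\<in>UNIV. der i (der i (mulv j (mulv j p))) \<alpha>)"
    unfolding laplacian_def mul_sq_def by (simp add: der_sum)
  also have "\<dots> = (\<Sum>i\<in>UNIV. \<Sum>j\<in>UNIV. mulv j (mulv j (der i (der i p))) \<alpha>)
      + (\<Sum>i\<in>UNIV. \<Sum>j\<in>UNIV. of_bool (i = j) * (4 * mulv j (der i p) \<alpha> + 2 * p \<alpha>))"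
    by (simp add: der_der_mulv_mulv sum.distrib)
  also have "(\<Sum>i\<in>UNIV. \<Sum>j\<in>UNIV. mulv j (mulv j (der i (der i p))) \<alpha>) = mul_sq (laplacian p) \<alpha>"
    unfolding laplacian_def mul_sq_def by (subst sum.swap) (simp add: mulv_sum)
  also have "(\<Sum>i\<in>UNIV. \<Sum>j\<in>UNIV. of_bool (i = j) * (4 * mulv j (der i p) \<alpha> + 2 * p \<alpha>))
      = (\<Sum>i\<in>UNIV. 4 * mulv i (der i p) \<alpha> + 2 * p \<alpha>)"
    by (simp add: of_bool_def if_distrib if_distribR cong: if_cong)
  also have "\<dots> = (2 * CARD('n) + 4 * sum \<alpha> UNIV) * p \<alpha>"
    by (simp add: mulv_der sum.distrib sum_distrib_left sum_distrib_right algebra_simps)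
  finally show ?thesis .
qed

lemma finite_multi_indices: "finite {\<alpha> :: 'n::finite \<Rightarrow> nat. sum \<alpha> UNIV = k}"
proof (rule finite_subset)
  show "{\<alpha> :: 'n \<Rightarrow> nat. sum \<alpha> UNIV = k} \<subseteq> UNIV \<rightarrow>\<^sub>E {..k}"
    by (auto simp: PiE_def Pi_def extensional_def intro: member_le_sum)
  show "finite (UNIV \<rightarrow>\<^sub>E {..k} :: ('n \<Rightarrow> nat) set)"
    by (intro finite_PiE) auto
qed

lemma fischer_commute: "fischer k p q = fischer k q p"
  by (simp add: fischer_def mult.commute mult.left_commute)

lemma fischer_sum_left: "fischer k (\<lambda>\<alpha>. \<Sum>j\<in>J. c j * f j \<alpha>) q = (\<Sum>j\<in>J. c j * fischer k (f j) q)"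
  unfolding fischer_def sum_distrib_left sum_distrib_right
  by (subst sum.swap) (simp add: ac_simps)

lemma fischer_mulv: "fischer (Suc k) (mulv i p) q = fischer k p (der i q)"
  for p q :: "'n::finite coeffs"
proof -
  let ?w = "\<lambda>\<alpha> :: 'n \<Rightarrow> nat. \<Prod>i\<in>UNIV. fact (\<alpha> i) :: real"
  have w: "?w (\<beta>(i := Suc (\<beta> i))) = (real (\<beta> i) + 1) * ?w \<beta>" for \<beta> :: "'n \<Rightarrow> nat"
    by (subst (1 2) prod.remove[of UNIV i]) (auto simp: algebra_simps intro!: prod.cong)
  have s: "sum (\<beta>(i := Suc (\<beta> i))) UNIV = Suc (sum \<beta> UNIV)" for \<beta> :: "'n \<Rightarrow> nat"
    by (subst (1 2) sum.remove[of UNIV i]) (auto intro!: sum.cong)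
  have "fischer (Suc k) (mulv i p) q
      = (\<Sum>\<alpha> | sum \<alpha> UNIV = Suc k \<and> \<alpha> i \<noteq> 0. ?w \<alpha> * mulv i p \<alpha> * q \<alpha>)"
    unfolding fischer_def
    by (rule sum.mono_neutral_right) (auto simp: finite_multi_indices mulv_def)
  also have "\<dots> = (\<Sum>\<beta> | sum \<beta> UNIV = k. ?w \<beta> * p \<beta> * der i q \<beta>)"
  proof (rule sum.reindex_bij_witness[where j = "\<lambda>\<alpha>. \<alpha>(i := \<alpha> i - 1)" and i = "\<lambda>\<beta>. \<beta>(i := Suc (\<beta> i))"])
    fix \<alpha> :: "'n \<Rightarrow> nat" assume \<alpha>: "\<alpha> \<in> {\<alpha>. sum \<alpha> UNIV = Suc k \<and> \<alpha> i \<noteq> 0}"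
    define \<beta> where "\<beta> = \<alpha>(i := \<alpha> i - 1)"
    have \<alpha>\<beta>: "\<alpha> = \<beta>(i := Suc (\<beta> i))" using \<alpha> by (auto simp: \<beta>_def)
    show "(\<alpha>(i := \<alpha> i - 1)) (i := Suc ((\<alpha>(i := \<alpha> i - 1)) i)) = \<alpha>" using \<alpha> by auto
    have "sum \<beta> UNIV = k" using s[of \<beta>] \<alpha> \<alpha>\<beta> by simp
    then show "\<alpha>(i := \<alpha> i - 1) \<in> {\<beta>. sum \<beta> UNIV = k}" by (simp add: \<beta>_def)
    have "?w \<beta> * p \<beta> * der i q \<beta> = ?w (\<beta>(i := Suc (\<beta> i))) * mulv i p (\<beta>(i := Suc (\<beta> i))) * q (\<beta>(i := Suc (\<beta> i)))"
      unfolding w by (simp add: der_def mulv_def)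
    then show "?w (\<alpha>(i := \<alpha> i - 1)) * p (\<alpha>(i := \<alpha> i - 1)) * der i q (\<alpha>(i := \<alpha> i - 1)) = ?w \<alpha> * mulv i p \<alpha> * q \<alpha>"
      unfolding \<alpha>\<beta>[symmetric] unfolding \<beta>_def .
  next
    fix \<beta> :: "'n \<Rightarrow> nat" assume "\<beta> \<in> {\<beta>. sum \<beta> UNIV = k}"
    then show "\<beta>(i := Suc (\<beta> i)) \<in> {\<alpha>. sum \<alpha> UNIV = Suc k \<and> \<alpha> i \<noteq> 0}"
      using s[of \<beta>] by simp
  qed auto
  finally show ?thesis by (simp add: fischer_def)
qed

lemma fischer_mul_lin: "fischer (Suc k) (mul_lin x p) q = fischer k p (der_dir x q)"
proof -
  have "fischer (Suc k) (mul_lin x p) q = (\<Sum>i\<in>UNIV. x $ i * fischer k p (der i q))"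
    unfolding mul_lin_def by (simp only: fischer_sum_left fischer_mulv)
  also have "\<dots> = fischer k p (der_dir x q)"
    unfolding der_dir_def by (simp only: fischer_commute[of k p] fischer_sum_left)
  finally show ?thesis .
qed

lemma fischer_mul_sq: "fischer (Suc (Suc k)) (mul_sq p) q = fischer k p (laplacian q)"
proof -
  have "fischer (Suc (Suc k)) (mul_sq p) q = (\<Sum>i\<in>UNIV. 1 * fischer k p (der i (der i q)))"
    unfolding mul_sq_def
    using fischer_sum_left[of "Suc (Suc k)" "\<lambda>i. 1" "\<lambda>i. mulv i (mulv i p)" UNIV q]
    by (simp add: fischer_mulv)
  also have "\<dots> = fischer k p (laplacian q)"
    unfolding laplacian_def fischer_commute[of k p]
    using fischer_sum_left[of k "\<lambda>i. 1" "\<lambda>i. der i (der i q)" UNIV p] by simp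
  finally show ?thesis .
qed

text \<open>\<open>lin_pow y m\<close> and, below, \<open>sq_lin_pow y j m\<close> are the polynomials \<open>(y \<bullet> z)\<^sup>m\<close> and
\<open>|z|\<^sup>2\<^sup>j (y \<bullet> z)\<^sup>m\<close> in \<open>z\<close>.\<close>

abbreviation lin_pow :: "real ^ 'n \<Rightarrow> nat \<Rightarrow> 'n::finite coeffs" where
  "lin_pow y m \<equiv> (mul_lin y ^^ m) unit_poly"

lemma der_unit_poly: "der i unit_poly = (\<lambda>_. 0)"
  by (auto simp: der_def unit_poly_def fun_eq_iff) 

lemma der_dir_lin_pow: "der_dir x (lin_pow y m) = (\<lambda>\<alpha>. m * (x \<bullet> y) * lin_pow y (m - 1) \<alpha>)"
proof (induction m)
  case 0
  show ?case by (simp add: der_dir_def der_unit_poly)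
next
  case (Suc m)
  have step: "der_dir x (mul_lin y p) = (\<lambda>\<alpha>. mul_lin y (der_dir x p) \<alpha> + (x \<bullet> y) * p \<alpha>)" for p
  proof
    fix \<alpha>
    have "der_dir x (mul_lin y p) \<alpha> = (\<Sum>i\<in>UNIV. \<Sum>j\<in>UNIV. x $ i * (y $ j * der i (mulv j p) \<alpha>))"
      unfolding der_dir_def mul_lin_def by (simp add: der_sum der_scale sum_distrib_left)
    also have "\<dots> = (\<Sum>i\<in>UNIV. \<Sum>j\<in>UNIV. x $ i * (y $ j * mulv j (der i p) \<alpha>))
        + (\<Sum>i\<in>UNIV. \<Sum>j\<in>UNIV. x $ i * (y $ j * (of_bool (i = j) * p \<alpha>)))"
      by (simp add: der_mulv distrib_left sum.distrib)
    also have "(\<Sum>i\<in>UNIV. \<Sum>j\<in>UNIV. x $ i * (y $ j * mulv j (der i p) \<alpha>)) = mul_lin y (der_dir x p) \<alpha>"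
      unfolding der_dir_def mul_lin_def
      by (subst sum.swap) (simp add: mulv_sum mulv_scale sum_distrib_left ac_simps)
    also have "(\<Sum>i\<in>UNIV. \<Sum>j\<in>UNIV. x $ i * (y $ j * (of_bool (i = j) * p \<alpha>))) = (x \<bullet> y) * p \<alpha>"
      by (simp add: of_bool_def if_distrib if_distribR inner_vec_def sum_distrib_left ac_simps cong: if_cong)
    finally show "der_dir x (mul_lin y p) \<alpha> = mul_lin y (der_dir x p) \<alpha> + (x \<bullet> y) * p \<alpha>" .
  qed
  have "mul_lin y (\<lambda>\<alpha>. c * p \<alpha>) = (\<lambda>\<alpha>. c * mul_lin y p \<alpha>)" for c p
    by (simp add: mul_lin_def mulv_scale sum_distrib_left ac_simps)
  then have "der_dir x (lin_pow y (Suc m)) = (\<lambda>\<alpha>. m * (x \<bullet> y) * lin_pow y (Suc (m - 1)) \<alpha> + (x \<bullet> y) * lin_pow y m \<alpha>)"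
    by (simp only: funpow.simps o_apply step Suc)
  then show ?case
    by (cases m) (auto simp: fun_eq_iff algebra_simps)
qed

lemma laplacian_lin_pow:
  "laplacian (lin_pow y m) = (\<lambda>\<alpha>. m * (real m - 1) * (y \<bullet> y) * lin_pow y (m - 2) \<alpha>)"
proof (induction m)
  case 0
  show ?case by (simp add: laplacian_def der_unit_poly) (simp add: der_def)
next
  case (Suc m)
  have sc: "mul_lin y (\<lambda>\<alpha>. c * p \<alpha>) = (\<lambda>\<alpha>. c * mul_lin y p \<alpha>)" for c p
    by (simp add: mul_lin_def mulv_scale sum_distrib_left ac_simps)
  have *: "laplacian (lin_pow y (Suc m)) = (\<lambda>\<alpha>. m * (real m - 1) * (y \<bullet> y) * lin_pow y (Suc (m - 2)) \<alpha>
      + 2 * (m * (y \<bullet> y) * lin_pow y (m - 1) \<alpha>))"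
    by (simp only: funpow.simps o_apply laplacian_mul_lin Suc der_dir_lin_pow sc)
  consider "m = 0" | "m = 1" | l where "m = Suc (Suc l)"
    by (metis One_nat_def not0_implies_Suc)
  then show ?case
    unfolding * by cases (auto simp: fun_eq_iff algebra_simps)
qed

lemma lin_pow_homogeneous: "sum \<alpha> UNIV \<noteq> m \<Longrightarrow> lin_pow y m \<alpha> = 0"
proof (induction m arbitrary: \<alpha>)
  case 0
  then show ?case by (auto simp: unit_poly_def)
next
  case (Suc m)
  have "mulv i (lin_pow y m) \<alpha> = 0" for i
  proof (cases "\<alpha> i = 0")
    case False
    then have "sum \<alpha> UNIV = Suc (sum (\<alpha>(i := \<alpha> i - 1)) UNIV)"
      by (subst (1 2) sum.remove[of UNIV i]) (auto intro!: sum.cong)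
    then show ?thesis using Suc by (simp add: mulv_def)
  qed (simp add: mulv_def)
  then show ?case by (simp add: mul_lin_def[of y "lin_pow y m"])
qed

lemma mul_sq_homogeneous:
  assumes "\<And>\<alpha>. sum \<alpha> UNIV \<noteq> d \<Longrightarrow> p \<alpha> = 0" "sum \<alpha> UNIV \<noteq> d + 2"
  shows "mul_sq p \<alpha> = 0"
proof -
  have "mulv i (mulv i p) \<alpha> = 0" for i
  proof (cases "\<alpha> i \<ge> 2")
    case True
    then have "sum \<alpha> UNIV = sum (\<alpha>(i := \<alpha> i - 2)) UNIV + 2"
      by (subst (1 2) sum.remove[of UNIV i]) (auto intro!: sum.cong)
    then show ?thesis using True assms by (auto simp: mulv_def numeral_2_eq_2 diff_diff_left)
  qed (auto simp: mulv_def)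
  then show ?thesis by (simp add: mul_sq_def)
qed

abbreviation sq_lin_pow :: "real ^ 'n \<Rightarrow> nat \<Rightarrow> nat \<Rightarrow> 'n::finite coeffs" where
  "sq_lin_pow y j m \<equiv> (mul_sq ^^ j) (lin_pow y m)"

lemma sq_lin_pow_homogeneous: "sum \<alpha> UNIV \<noteq> 2 * j + m \<Longrightarrow> sq_lin_pow y j m \<alpha> = 0"
proof (induction j arbitrary: \<alpha>)
  case 0
  then show ?case by (simp add: lin_pow_homogeneous)
next
  case (Suc j)
  then show ?case using mul_sq_homogeneous[of "2 * j + m" "sq_lin_pow y j m" \<alpha>] by simp
qed

lemma laplacian_sum: "laplacian (\<lambda>\<alpha>. \<Sum>j\<in>J. c j * f j \<alpha>) = (\<lambda>\<alpha>. \<Sum>j\<in>J. c j * laplacian (f j) \<alpha>)"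
  unfolding laplacian_def sum_distrib_left der_sum der_scale by (subst sum.swap) simp

lemma mul_sq_add: "mul_sq (\<lambda>\<alpha>. c * f \<alpha> + d * g \<alpha>) = (\<lambda>\<alpha>. c * mul_sq f \<alpha> + d * mul_sq g \<alpha>)"
proof -
  have *: "mulv j (\<lambda>\<alpha>. c * f \<alpha> + d * g \<alpha>) = (\<lambda>\<alpha>. c * mulv j f \<alpha> + d * mulv j g \<alpha>)" for f g c d j
    by (auto simp: mulv_def fun_eq_iff)
  show ?thesis unfolding mul_sq_def * by (simp add: sum.distrib sum_distrib_left)
qed

lemma laplacian_sq_lin_pow:
  fixes y :: "real ^ 'n::finite"
  shows "laplacian (sq_lin_pow y j m) = (\<lambda>\<alpha>.
      2 * real j * (real CARD('n) + 2 * real j + 2 * real m - 2) * sq_lin_pow y (j - 1) m \<alpha>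
    + real m * (real m - 1) * (y \<bullet> y) * sq_lin_pow y j (m - 2) \<alpha>)"
proof (induction j)
  case 0
  show ?case by (simp add: laplacian_lin_pow)
next
  case (Suc j)
  have "laplacian (sq_lin_pow y (Suc j) m) = (\<lambda>\<alpha>. mul_sq (laplacian (sq_lin_pow y j m)) \<alpha>
      + (2 * real CARD('n) + 4 * (2 * j + m)) * sq_lin_pow y j m \<alpha>)"
  proof
    fix \<alpha> :: "'n \<Rightarrow> nat"
    show "laplacian (sq_lin_pow y (Suc j) m) \<alpha> = mul_sq (laplacian (sq_lin_pow y j m)) \<alpha>
      + (2 * real CARD('n) + 4 * (2 * j + m)) * sq_lin_pow y j m \<alpha>"
      using sq_lin_pow_homogeneous[of \<alpha> j m y]
      by (cases "sum \<alpha> UNIV = 2 * j + m") (simp_all add: laplacian_mul_sq)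
  qed
  also have "\<dots> = (\<lambda>\<alpha>. 2 * real j * (real CARD('n) + 2 * real j + 2 * real m - 2) * sq_lin_pow y (Suc (j - 1)) m \<alpha>
    + m * (real m - 1) * (y \<bullet> y) * sq_lin_pow y (Suc j) (m - 2) \<alpha>
      + (2 * real CARD('n) + 4 * (2 * j + m)) * sq_lin_pow y j m \<alpha>)"
    unfolding Suc mul_sq_add by simp
  also have "\<dots> = (\<lambda>\<alpha>. 2 * real (Suc j) * (real CARD('n) + 2 * real (Suc j) + 2 * real m - 2) * sq_lin_pow y (Suc j - 1) m \<alpha>
    + m * (real m - 1) * (y \<bullet> y) * sq_lin_pow y (Suc j) (m - 2) \<alpha>)"
    by (cases j) (auto simp: fun_eq_iff algebra_simps)
  finally show ?case .
qed

section \<open>Positive definiteness of the Gegenbauer kernels\<close>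

text \<open>With the coefficients that make it harmonic (see \<open>laplacian_zonal\<close>) this is, up to a factor, the
zonal harmonic of degree \<open>k\<close> with pole \<open>y\<close>.\<close>

definition zonal :: "(nat \<Rightarrow> real) \<Rightarrow> nat \<Rightarrow> real ^ 'n \<Rightarrow> 'n::finite coeffs" where
  "zonal c k y = (\<lambda>\<alpha>. \<Sum>j\<le>k div 2. c j * (y \<bullet> y) ^ j * sq_lin_pow y j (k - 2 * j) \<alpha>)"

text \<open>The Laplacian sends the summand of index \<open>j\<close> to two terms, and the recursion for \<open>c\<close> says that
the second term of index \<open>j\<close> cancels the first one of index \<open>j + 1\<close>.\<close>

lemma laplacian_zonal:
  fixes y :: "real ^ 'n::finite"
  assumes c: "\<And>j. 2 * j + 2 \<le> k \<Longrightarrow> 2 * (real j + 1) * (real CARD('n) + 2 * k - 2 * j - 4) * c (Suc j)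
    = - (real k - 2 * j) * (real k - 2 * j - 1) * c j"
  shows "laplacian (zonal c k y) = (\<lambda>_. 0)"
proof
  fix \<alpha> :: "'n \<Rightarrow> nat"
  define f where "f j = c j * (y \<bullet> y) ^ j * (2 * real j * (real CARD('n) + 2 * real j + 2 * real (k - 2 * j) - 2)
    * sq_lin_pow y (j - 1) (k - 2 * j) \<alpha>)" for j
  define g where "g j = c j * (y \<bullet> y) ^ j * (real (k - 2 * j) * (real (k - 2 * j) - 1) * (y \<bullet> y)
    * sq_lin_pow y j (k - 2 * j - 2) \<alpha>)" for j
  have fg: "f (Suc j) = - g j" if "2 * j + 2 \<le> k" for j
  proof -
    have r: "real (k - 2 * j) = real k - 2 * j" "real (k - 2 * Suc j) = real k - 2 * j - 2"
      using that by (simp_all add: of_nat_diff)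
    have k: "k - 2 * j - 2 = k - 2 * Suc j" by simp
    have "f (Suc j) = (2 * (real j + 1) * (real CARD('n) + 2 * k - 2 * j - 4) * c (Suc j))
        * ((y \<bullet> y) ^ Suc j * sq_lin_pow y j (k - 2 * Suc j) \<alpha>)"
      unfolding f_def r by (simp add: algebra_simps)
    also have "\<dots> = - g j"
      unfolding g_def r k c[OF that] by (simp add: algebra_simps)
    finally show ?thesis .
  qed
  have "(\<Sum>j\<le>J. f j + g j) = g J" if "2 * J \<le> k" for J
    using that by (induction J) (simp_all add: fg, simp add: f_def)
  then have "(\<Sum>j\<le>k div 2. f j + g j) = g (k div 2)" by simp
  also have "g (k div 2) = 0"
  proof -
    have "k - 2 * (k div 2) = 0 \<or> k - 2 * (k div 2) = 1" by linarith
    then show ?thesis by (auto simp: g_def)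
  qed
  finally show "laplacian (zonal c k y) \<alpha> = 0"
    unfolding zonal_def laplacian_sum laplacian_sq_lin_pow f_def g_def by (simp only: distrib_left)
qed

lemma fischer_lin_pow: "fischer m (lin_pow x m) (lin_pow y m) = fact m * (x \<bullet> y) ^ m"
proof (induction m)
  case 0
  have "{\<alpha> :: 'a \<Rightarrow> nat. sum \<alpha> UNIV = 0} = {\<lambda>_. 0}" by (auto simp: fun_eq_iff)
  then show ?case by (simp add: fischer_def unit_poly_def del: sum_eq_0_iff)
next
  case (Suc m)
  have "fischer (Suc m) (lin_pow x (Suc m)) (lin_pow y (Suc m))
      = fischer m (lin_pow x m) (\<lambda>\<alpha>. Suc m * (x \<bullet> y) * lin_pow y m \<alpha>)"
    using fischer_mul_lin[of m x "lin_pow x m" "lin_pow y (Suc m)"] der_dir_lin_pow[of x "Suc m" y] by simp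
  also have "\<dots> = Suc m * (x \<bullet> y) * fischer m (lin_pow x m) (lin_pow y m)"
    by (simp add: fischer_def sum_distrib_left ac_simps)
  finally show ?case by (simp add: Suc)
qed

lemma fischer_lin_pow_sq_lin_pow:
  "fischer (2 * j + m) (lin_pow x (2 * j + m)) (sq_lin_pow y j m) = fact (2 * j + m) * (x \<bullet> x) ^ j * (x \<bullet> y) ^ m"
proof (induction j)
  case 0
  show ?case by (simp add: fischer_lin_pow)
next
  case (Suc j)
  let ?k = "2 * j + m"
  have "fischer (2 * Suc j + m) (lin_pow x (2 * Suc j + m)) (sq_lin_pow y (Suc j) m)
      = fischer ?k (sq_lin_pow y j m) (laplacian (lin_pow x (Suc (Suc ?k))))"
    using fischer_mul_sq[of ?k "sq_lin_pow y j m" "lin_pow x (Suc (Suc ?k))"]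
    by (simp add: fischer_commute[of _ "lin_pow x _"] fischer_commute[of _ "mul_lin x _"])
  also have "\<dots> = fischer ?k (sq_lin_pow y j m) (\<lambda>\<alpha>. (real ?k + 2) * (real ?k + 1) * (x \<bullet> x) * lin_pow x ?k \<alpha>)"
    unfolding laplacian_lin_pow by (simp add: add.commute del: funpow.simps)
  also have "\<dots> = (real ?k + 2) * (real ?k + 1) * (x \<bullet> x) * fischer ?k (lin_pow x ?k) (sq_lin_pow y j m)"
    by (simp add: fischer_def sum_distrib_left ac_simps)
  also have "\<dots> = fact (2 * Suc j + m) * (x \<bullet> x) ^ Suc j * (x \<bullet> y) ^ m"
    by (simp add: Suc add.commute[of 2] del: funpow.simps)
  finally show ?case .
qed

text \<open>For the coefficients of \<open>laplacian_zonal\<close> this is a positive multiple of the Gegenbauer polynomial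
of degree \<open>k\<close> and parameter \<open>n/2 - 1\<close>, made homogeneous by \<open>w = |x|\<^sup>2 |y|\<^sup>2\<close> and
\<open>s = x \<bullet> y\<close>.\<close>

definition gegen :: "(nat \<Rightarrow> real) \<Rightarrow> nat \<Rightarrow> real \<Rightarrow> real \<Rightarrow> real" where
  "gegen c k s w = (\<Sum>j\<le>k div 2. c j * w ^ j * s ^ (k - 2 * j))"

text \<open>The zonal polynomial of \<open>x\<close> is \<open>c 0 (x \<bullet> z)\<^sup>k\<close> plus a multiple of \<open>|z|\<^sup>2\<close>. The multiple is orthogonal
to the harmonic zonal polynomial of \<open>y\<close>, and pairing with \<open>(x \<bullet> z)\<^sup>k\<close> evaluates at \<open>x\<close>.\<close>

lemma fischer_zonal:
  fixes x y :: "real ^ 'n::finite"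
  assumes c: "\<And>j. 2 * j + 2 \<le> k \<Longrightarrow> 2 * (real j + 1) * (real CARD('n) + 2 * k - 2 * j - 4) * c (Suc j)
    = - (real k - 2 * j) * (real k - 2 * j - 1) * c j"
  shows "fischer k (zonal c k x) (zonal c k y) = c 0 * fact k * gegen c k (x \<bullet> y) ((x \<bullet> x) * (y \<bullet> y))"
proof -
  have 0: "fischer k (sq_lin_pow x j (k - 2 * j)) (zonal c k y) = 0" if j: "j \<in> {..k div 2} - {0}" for j
  proof -
    obtain i where i: "j = Suc i" using j by (cases j) auto
    obtain l where l: "k = Suc (Suc l)"
    proof
      show "k = Suc (Suc (k - 2))" using j i by simp
    qed
    show ?thesis
      using fischer_mul_sq[of l "sq_lin_pow x i (k - 2 * j)" "zonal c k y"] laplacian_zonal[where y = y, OF c]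
      by (simp add: i l fischer_def)
  qed
  have "fischer k (zonal c k x) (zonal c k y)
      = (\<Sum>j\<le>k div 2. c j * (x \<bullet> x) ^ j * fischer k (sq_lin_pow x j (k - 2 * j)) (zonal c k y))"
    by (subst zonal_def) (simp only: fischer_sum_left)
  also have "\<dots> = c 0 * fischer k (lin_pow x k) (zonal c k y)"
    by (subst sum.remove[of _ 0]) (simp_all add: 0)
  also have "fischer k (lin_pow x k) (zonal c k y)
      = (\<Sum>j\<le>k div 2. c j * (y \<bullet> y) ^ j * fischer k (lin_pow x k) (sq_lin_pow y j (k - 2 * j)))"
    unfolding zonal_def fischer_commute[of k "lin_pow x k"] by (simp only: fischer_sum_left)
  also have "\<dots> = fact k * gegen c k (x \<bullet> y) ((x \<bullet> x) * (y \<bullet> y))"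
    unfolding gegen_def sum_distrib_left
  proof (intro sum.cong refl)
    fix j assume "j \<in> {..k div 2}"
    then have "2 * j + (k - 2 * j) = k" by auto
    then show "c j * (y \<bullet> y) ^ j * fischer k (lin_pow x k) (sq_lin_pow y j (k - 2 * j))
        = fact k * (c j * (x \<bullet> x * (y \<bullet> y)) ^ j * (x \<bullet> y) ^ (k - 2 * j))"
      using fischer_lin_pow_sq_lin_pow[of j "k - 2 * j" x y] by (simp add: power_mult_distrib)
  qed
  finally show ?thesis by simp
qed

text \<open>Schoenberg's theorem: the kernel is a Gram matrix of zonal polynomials, so the double sum is a
squared Fischer norm.\<close>

lemma gegen_positive_definite:
  fixes x :: "'a \<Rightarrow> real ^ 'n::finite" and r :: "'a \<Rightarrow> real"
  assumes c: "\<And>j. 2 * j + 2 \<le> k \<Longrightarrow> 2 * (real j + 1) * (real CARD('n) + 2 * k - 2 * j - 4) * c (Suc j)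
    = - (real k - 2 * j) * (real k - 2 * j - 1) * c j"
    and pos: "c 0 > 0"
  shows "(\<Sum>i\<in>A. \<Sum>j\<in>A. r i * r j * gegen c k (x i \<bullet> x j) ((x i \<bullet> x i) * (x j \<bullet> x j))) \<ge> 0"
proof -
  define h where "h = (\<lambda>\<alpha>. \<Sum>i\<in>A. r i * zonal c k (x i) \<alpha>)"
  have "0 \<le> fischer k h h"
    unfolding fischer_def by (intro sum_nonneg) (simp add: mult.assoc prod_nonneg)
  also have "fischer k h h = (\<Sum>i\<in>A. r i * (\<Sum>j\<in>A. r j * fischer k (zonal c k (x j)) (zonal c k (x i))))"
    by (subst (1) h_def, subst fischer_sum_left, subst fischer_commute, subst h_def, subst fischer_sum_left) simp
  also have "\<dots> = (\<Sum>i\<in>A. \<Sum>j\<in>A. c 0 * fact k * (r i * r j * gegen c k (x i \<bullet> x j) ((x i \<bullet> x i) * (x j \<bullet> x j))))"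
    unfolding sum_distrib_left
    by (intro sum.cong refl, subst fischer_zonal[OF c]) (simp_all add: inner_commute mult_ac)
  also have "\<dots> = c 0 * fact k * (\<Sum>i\<in>A. \<Sum>j\<in>A. r i * r j * gegen c k (x i \<bullet> x j) ((x i \<bullet> x i) * (x j \<bullet> x j)))"
    by (simp only: sum_distrib_left)
  finally have *: "0 \<le> c 0 * fact k * (\<Sum>i\<in>A. \<Sum>j\<in>A. r i * r j * gegen c k (x i \<bullet> x j) ((x i \<bullet> x i) * (x j \<bullet> x j)))" .
  have "0 \<le> b" if "0 \<le> a * b" "0 < a" for a b :: real
    using that by (simp add: zero_le_mult_iff)
  from this[OF *] pos show ?thesis by simp
qed

section \<open>Integer polynomials in three variables\<close>

text \<open>Polynomials in \<open>u\<close>, \<open>v\<close>, \<open>t\<close> are dense coefficient lists nested three deep: powers of \<open>t\<close> outside,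
then of \<open>u\<close>, then of \<open>v\<close>. The operations are written so that rewriting evaluates them quickly: all
additions run along the lists, and products of large integers occur only in the quadratic forms and
Gram polynomials of the certificate.\<close>

fun ladd :: "('a \<Rightarrow> 'a \<Rightarrow> 'a) \<Rightarrow> 'a list \<Rightarrow> 'a list \<Rightarrow> 'a list" where
  "ladd f [] ys = ys"
| "ladd f (x # xs) [] = x # xs"
| "ladd f (x # xs) (y # ys) = f x y # ladd f xs ys"

abbreviation add2 :: "int list list \<Rightarrow> int list list \<Rightarrow> int list list" where
  "add2 \<equiv> ladd (ladd (+))"

abbreviation add3 :: "int list list list \<Rightarrow> int list list list \<Rightarrow> int list list list" where
  "add3 \<equiv> ladd add2"

fun horner :: "('a \<Rightarrow> real) \<Rightarrow> real \<Rightarrow> 'a list \<Rightarrow> real" where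
  "horner e x [] = 0"
| "horner e x (a # p) = e a + x * horner e x p"

abbreviation ev1 :: "real \<Rightarrow> int list \<Rightarrow> real" where
  "ev1 \<equiv> horner real_of_int"

abbreviation ev2 :: "real \<Rightarrow> real \<Rightarrow> int list list \<Rightarrow> real" where
  "ev2 u v \<equiv> horner (ev1 v) u"

abbreviation ev3 :: "real \<Rightarrow> real \<Rightarrow> real \<Rightarrow> int list list list \<Rightarrow> real" where
  "ev3 u v t \<equiv> horner (ev2 u v) t"

text \<open>A coefficient with the exponents of \<open>u\<close>, \<open>v\<close> and \<open>t\<close>.\<close>

type_synonym monom = "int \<times> nat \<times> nat \<times> nat"

fun mul_term :: "monom \<Rightarrow> int list list list \<Rightarrow> int list list list" where
  "mul_term (c, a, b, k) P =
     replicate k [] @ map (\<lambda>Q. replicate a [] @ map (\<lambda>R. replicate b 0 @ map ((*) c) R) Q) P"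

fun lin_comb :: "int list \<Rightarrow> monom list list \<Rightarrow> int list list list" where
  "lin_comb (x # xs) (b # B) = foldr (\<lambda>m. add3 (mul_term m [[[x]]])) b (lin_comb xs B)"
| "lin_comb _ _ = []"

text \<open>A quadratic form is the list of the rows of its upper triangle, with the off-diagonal entries
doubled. In \<open>sum_sq_form\<close> the \<open>i\<close>-th row of \<open>W\<close> is a linear form in the basis elements from the
\<open>i\<close>-th one on: the rows are the columns of a Cholesky factor without their leading zeros.\<close>

fun sq_form :: "int list \<Rightarrow> int list list" where
  "sq_form [] = []"
| "sq_form (x # xs) = (x * x # map ((*) (2 * x)) xs) # sq_form xs"

fun sum_sq_form :: "int list list \<Rightarrow> int list list" where
  "sum_sq_form [] = []"
| "sum_sq_form (w # W) = add2 (sq_form w) ([] # sum_sq_form W)"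

fun form_poly :: "int list list \<Rightarrow> monom list list \<Rightarrow> int list list list" where
  "form_poly (r # G) (b # B) = foldr (\<lambda>m. add3 (mul_term m (lin_comb r (b # B)))) b (form_poly G B)"
| "form_poly _ _ = []"

definition sos :: "int list list \<Rightarrow> monom list list \<Rightarrow> int list list list" where
  "sos W B = form_poly (sum_sq_form W) B"

text \<open>For the kernel, a row \<open>w\<close> is a polynomial in one variable, and \<open>gram_poly W\<close> is the sum of the
products \<open>w(u) w(v)\<close>.\<close>

fun outer :: "int list \<Rightarrow> int list list" where
  "outer w = map (\<lambda>x. map ((*) x) w) w"

definition gram_poly :: "int list list \<Rightarrow> int list list" where
  "gram_poly W = foldr (\<lambda>w. add2 (outer w)) W []"

text \<open>Multiplication by \<open>(1 - u\<^sup>2)(1 - v\<^sup>2)\<close>.\<close>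

definition mul_w :: "int list list \<Rightarrow> int list list" where
  "mul_w P = (let Q = add2 P ([] # [] # map (map uminus) P)
     in add2 Q (map (\<lambda>R. 0 # 0 # map uminus R) Q))"

text \<open>Here the outermost variable is \<open>s\<close>, the inner product of the projections to the equator; the
substitution \<open>s = t - u v\<close> made by \<open>subst_s\<close> follows once for the whole kernel.\<close>

fun gegen_poly :: "nat \<Rightarrow> int list \<Rightarrow> int list list \<Rightarrow> int list list list" where
  "gegen_poly m [] Q = []"
| "gegen_poly m (z # zs) Q =
     add3 (replicate m [] @ [map (map ((*) z)) Q]) (gegen_poly (m - 2) zs (mul_w Q))"

definition subst_s :: "int list list list \<Rightarrow> int list list list" where
  "subst_s P = foldr (\<lambda>Q A. add3 [Q] (add3 ([] # A) (mul_term (-1, 1, 1, 0) A))) P []"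

fun kernel_sum :: "nat \<Rightarrow> int list list \<Rightarrow> int list list list \<Rightarrow> int list list list" where
  "kernel_sum k (z # zs) (W # Ws) = add3 (gegen_poly k z (gram_poly W)) (kernel_sum (Suc k) zs Ws)"
| "kernel_sum k _ _ = []"

text \<open>Restriction to \<open>v = u\<close> and, in \<open>diag3\<close>, to \<open>t = 1\<close>.\<close>

fun diag2 :: "int list list \<Rightarrow> int list" where
  "diag2 [] = []"
| "diag2 (p # P) = ladd (+) p (0 # diag2 P)"

definition diag3 :: "int list list list \<Rightarrow> int list" where
  "diag3 P = diag2 (foldr add2 P [])"

definition norm3 :: "int list list list \<Rightarrow> int" where
  "norm3 P = (\<Sum>Q\<leftarrow>P. \<Sum>R\<leftarrow>Q. \<Sum>c\<leftarrow>R. \<bar>c\<bar>)"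

fun swap_term :: "monom \<Rightarrow> monom" where "swap_term (c, a, b, k) = (c, b, a, k)"

text \<open>The kernel is invariant under exchange of \<open>u\<close> and \<open>v\<close>. An invariant sum of squares splits into
squares of symmetric and of antisymmetric polynomials, which roughly halves the quadratic forms.\<close>

definition sym_basis :: "(nat \<times> nat \<times> nat) list \<Rightarrow> monom list list" where
  "sym_basis = map (\<lambda>(a, b, k). if a = b then [(1, a, b, k)] else [(1, a, b, k), (1, b, a, k)])"

definition anti_basis :: "(nat \<times> nat \<times> nat) list \<Rightarrow> monom list list" where
  "anti_basis = map (\<lambda>(a, b, k). [(1, a, b, k), (-1, b, a, k)])"

definition mono_basis :: "(nat \<times> nat \<times> nat) list \<Rightarrow> monom list list" where
  "mono_basis = map (\<lambda>(a, b, k). [(1, a, b, k)])"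

section \<open>The certificate\<close>

text \<open>The integers come from a numerical solution of a semidefinite programme, whose unknowns are the
kernel and the sums of squares. The bound was fixed at \<open>183.5\<close>, which is above the optimum, and the
trace was minimized; this gives matrices of small rank. Their Cholesky factors were multiplied by
\<open>2\<^sup>2\<^sup>7\<close> and rounded. Hence the constant \<open>1\<close> of the
programme appears as \<open>2\<^sup>5\<^sup>4\<close>, and the identities hold up to small residuals only.

The \<open>k\<close>-th list in \<open>kernel_rows\<close> belongs to the Gegenbauer kernel of degree \<open>k\<close>, for \<open>k \<le> 7\<close>.
The \<open>k\<close>-th list in \<open>gegen_coeffs\<close> is the Gegenbauer polynomial of that degree in dimension \<open>7\<close>,
scaled to integers: its \<open>j\<close>-th entry is the coefficient of \<open>w\<^sup>j s\<^sup>k\<^sup>-\<^sup>2\<^sup>j\<close>.\<close>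

definition kernel_rows :: "int list list list" where
  "kernel_rows =
   [[[69512927, -233981478, 771088409, -3336181955, -739269687, 6749633669, -3508772790],
     [-1791566, -32021626, -1055641393, 2698543142, -1808597664, 0, 1932596019],
     [2239973, -303089312, 338123147, 0, 875758402, 0, -438847596],
     [-2053833, -61991123, 146478522, 0, 0, 0, -10912033]],
    [[-167137598, -370976396, -607215677, -4375207854, 11411812836, -5084006343, -34001228],
     [285855970, -481633087, 865160974, -5091053143, 0, 6735911715, -4194464376],
     [155288207, 37023867, -1915196029, 4106314390, 0, 0, 260389635],
     [100721653, -283961, 72658557, 0, 0, 0, 2351591897],
     [5021442, -613732223, 1516566186]],
    [[-103925514, -164926497, -471534987, -2391482362, 5006319108, -2920879148, -150185785],
     [-118446652, 279794660, -931961575, 3158015236, 0, -911000375, 26365152],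
     [73649480, -342253942, 177160111, 0, 0, 1905722047, -475658416],
     [-105931978, -102863647, 787350205, 0, 0, 0, -148600647],
     [-160031523, 4546930, 0, 0, 0, 0, 285669521]],
    [[-147483825, 638631183, -2885509600, 8563471749, -5588042262, -491690246],
     [-395214894, 103593876, -653216914, 0, 4736124512, -1974131383],
     [57250693, 49679424, 3252337793, 0, 0, -423385297],
     [153926217, 474078379, 0, 0, 0, 865723719],
     [404395330, -297266764]],
    [[-72461984, 265555011, -1229904767, 2143846432, -606969128],
     [50135890, 22194796, 1206771139, 0, -777590478],
     [-171347067, 112487865, 0, 0, 474116086],
     [133847533, 135211174]],
    [[74035116, -180021953, 686519180, -415434001],
     [-22314166, -90594094, 0, 449005723],
     [96384518, 82504580]],
    [[49021190, -175881115, 511191020],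
     [91841727, 145988480]],
    [[34940631, 220100223]]]"

definition gegen_coeffs :: "int list list" where
  "gegen_coeffs = [[1], [1], [7, -1], [3, -1], [33, -18, 1], [143, -110, 15], [143, -143, 33, -1], [221, -273, 91, -7]]"

text \<open>The sums of squares, with their multipliers: \<open>1\<close> (\<open>free\<close>), \<open>u(1 - u)\<close> or \<open>v(1 - v)\<close>
(\<open>equator\<close>) and \<open>(1 + t)(1 - 2t)\<close> (\<open>code\<close>) off the diagonal, \<open>1\<close> and \<open>u(1 - u)\<close> on it. The basis
elements \<open>(a, b, k)\<close> stand for \<open>u\<^sup>a v\<^sup>b t\<^sup>k\<close> in the order of the pivots.\<close>

definition free_sym_basis :: "monom list list" where
  "free_sym_basis = sym_basis
     [(1,1,3), (2,2,0), (2,2,1), (1,1,2), (2,1,0), (1,0,0), (3,0,0), (3,1,0), (3,2,0), (3,3,0),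
     (4,0,0), (4,1,0), (4,2,0), (0,0,1), (1,0,1), (1,1,1), (2,0,1), (2,1,1), (1,1,0), (3,0,1),
     (3,1,1), (3,2,1), (0,0,2), (1,0,2), (2,0,0), (2,0,2), (2,1,2), (2,2,2), (0,0,3), (1,0,3),
     (0,0,0), (0,0,4)]"

definition free_sym_rows :: "int list list" where
  "free_sym_rows =
    [[9644540803, 1982809110, 4042442689, 6968592125, 1140515636, 39720222, 97400541, -91692245,
     -1599218009, -445719566, 12472457, -637222203, 197645918, 307781953, -113206549, -2211932989,
     -309263726, -2653374910, -984819127, 354402724, 1776735921, 2042729555, 269001279, -189790247,
     -156225767, 543258698, -6499600961, -2120573013, -1210824794, 636180096, 3920279, -1176927043],
     [6791590444, -3441627395, 289397490, -2664328551, 7565516, -39995349, 2069019090, -3350048732,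
     926604077, 29546820, -381509833, -121559100, -65420196, 72713999, -529248068, -240240095,
     1490976193, 810328489, 273074375, -1192139743, 1942474036, -56875934, -46551389, 3940141,
     51338670, 297303272, -2076807883, 257662223, -73243123, -899722, 250514727],
     [2382442812, -700710061, -101127727, -23497719, -183425770, 60077374, -551406286, 2138653120,
     101970142, 434824288, -1069446814, 106431642, -132417429, 968331828, 424360951, -1865461125,
     114580001, -457467774, 1082661131, -892555210, 92842308, 16894475, 104046146, 31705011,
     115493566, 1917603470, -418725781, 118955777, 1382113, -407211983],
     [1300512941, 488394459, 11786527, 57831373, -290915406, -185363645, 279470472, -35601449,
     -181408561, 211865529, -113733068, 153773463, -477649802, -518002730, 517158942, -308564898,
     557904804, -192187547, 120576585, -99198897, -52743864, -33290009, 33127533, -931667656,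
     -982212923, 447566664, -117321943, -1483112, 435543588]]"

definition free_anti_basis :: "monom list list" where
  "free_anti_basis = anti_basis
     [(2,1,2), (2,1,1), (2,1,0), (3,0,0), (3,1,0), (3,2,0), (4,0,0), (4,1,0), (4,2,0), (1,0,1),
     (2,0,1), (2,0,0), (3,0,1), (3,1,1), (3,2,1), (1,0,2), (2,0,2), (1,0,0), (1,0,3)]"

definition free_anti_rows :: "int list list" where
  "free_anti_rows =
    [[2159005455, 664128675, -424437199, -499510749, -106715729, 1755073104, 257360607, 110573940,
     -183960989, -81997250, 456019324, 300334870, -528105411, -1520011784, 1056967770, 29521088,
     -54687905, -57012140, -44527699],
     [1870361195, 656172952, -326187734, -1609975238, 108294873, 157400984, 912821231, 957703193,
     -23963121, 75997447, 213708528, -76446638, -1451861858, -1443515520, 59320183, -114605155,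
     -44718935, 23253216]]"

definition equator_basis :: "monom list list" where
  "equator_basis = mono_basis
     [(1,2,0), (1,1,0), (2,0,0), (1,0,0), (0,1,0), (0,0,0), (0,2,0), (2,1,0), (2,2,0), (0,0,1),
     (0,1,1), (1,0,1), (1,1,1), (0,0,2)]"

definition equator_rows :: "int list list" where
  "equator_rows =
    [[4087114170, -2482965713, -91455869, 87344591, 659375421, -20419985, -1107793111, 2282016261,
     -3666517298, 6810733, 17003867, -13558528, -35460531, 901040],
     [752668631, -612704946, 590110323, -226589442, -138553251, 101781441, -588105320, -406914599,
     3703270, -156788446, -7673978, 319453912, -1382367],
     [858799, -825901, 64297, 193661, -128406, -250543, 510394, -8796, 159889, 17920, -325157, 1203]]"

definition code_sym_basis :: "monom list list" where
  "code_sym_basis = sym_basis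
     [(1,1,1), (1,1,2), (2,2,0), (2,0,0), (2,1,0), (1,1,0), (3,0,0), (3,1,0), (0,0,1), (1,0,1),
     (0,0,0), (2,0,1), (2,1,1), (0,0,2), (1,0,2), (1,0,0), (0,0,3)]"

definition code_sym_rows :: "int list list" where
  "code_sym_rows =
    [[9671833798, 6087224519, -3373107656, 1427110, -1705660113, 1089184024, -6147387, 2834337285,
     -223193652, 80942527, -2760807, -37340266, -6378930372, -1000745539, 100743178, 10834976,
     -1118858396],
     [4463372804, -1421054295, 312742679, 1332278019, -638860249, -216488821, -714569135, 122325849,
     -1171453290, 1703062, 808747198, 1963521731, 322610076, -1573421745, -99631781, 182125797],
     [2065617149, 52906176, -462807458, 13585337, -38132838, -181059091, -66962570, -398957909,
     -712630, 275109327, 76883235, -500882176, -531165261, -10739221, -720014438]]"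

definition code_anti_basis :: "monom list list" where
  "code_anti_basis = anti_basis
     [(3,1,0), (2,0,0), (2,1,0), (3,0,0), (1,0,0), (1,0,1), (2,0,1), (2,1,1), (1,0,2)]"

definition code_anti_rows :: "int list list" where
  "code_anti_rows =
    [[537250181, -33023005, -487815441, 22585426, 10132172, 125895419, -104143411, 373441779,
     155170591]]"

definition diag_free_basis :: "monom list list" where
  "diag_free_basis = mono_basis
     [(5,0,0), (4,0,0), (2,0,0), (3,0,0), (1,0,0), (0,0,0), (6,0,0), (7,0,0), (8,0,0)]"

definition diag_free_rows :: "int list list" where
  "diag_free_rows =
    [[1388769339, -507169055, -804238036, 853313115, 185042031, 26234, -955632918, 495126356,
     -701066099],
     [922063, -71486, -502156, 48786, 11, 95284, -699204, 188185]]"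

definition diag_cap_basis :: "monom list list" where
  "diag_cap_basis = mono_basis
     [(2,0,0), (6,0,0), (7,0,0), (3,0,0), (4,0,0), (5,0,0), (1,0,0), (0,0,0)]"

definition diag_cap_rows :: "int list list" where
  "diag_cap_rows =
    [[5615750187, -543009687, 67775655, 2267798027, -2918734653, -228485717, -5403152109,
     1178811900],
     [1159844498, -55668446, 391432365, -1064599209, -510799271, 152734360, -56075443],
     [695558276, -571203620, -213753966, -203910219, 460075721, -136875255]]"

definition kernel_poly :: "int list list list" where
  "kernel_poly = subst_s (kernel_sum 0 gegen_coeffs kernel_rows)"

definition equator_poly :: "int list list list" where
  "equator_poly = (let P = sos equator_rows equator_basis; Q = sos equator_rows (map (map swap_term) equator_basis)
     in add3 (add3 (mul_term (1, 1, 0, 0) P) (mul_term (-1, 2, 0, 0) P))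
             (add3 (mul_term (1, 0, 1, 0) Q) (mul_term (-1, 0, 2, 0) Q)))"

definition code_poly :: "int list list list" where
  "code_poly = (let P = add3 (sos code_sym_rows code_sym_basis) (sos code_anti_rows code_anti_basis)
     in add3 (mul_term (1, 0, 0, 0) P) (add3 (mul_term (-1, 0, 0, 1) P) (mul_term (-2, 0, 0, 2) P)))"

text \<open>Were the certificate exact, both residuals would vanish. Off the diagonal it would show that the
kernel is at most \<open>-1\<close>, on the diagonal that it is at most \<open>182.5\<close>, both in units of \<open>2\<^sup>5\<^sup>4\<close>; note
that \<open>365 * 2 ^ 53\<close> is \<open>182.5 * 2 ^ 54\<close>. The factor \<open>2\<close> clears the denominator of the multiplier
\<open>(1 + t)(1/2 - t)\<close>.\<close>

definition off_diag_residual :: "int list list list" where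
  "off_diag_residual = add3 (mul_term (2, 0, 0, 0)
      (add3 kernel_poly (add3 [[[2 ^ 54]]]
        (add3 (sos free_sym_rows free_sym_basis) (sos free_anti_rows free_anti_basis)))))
     (add3 equator_poly code_poly)"

definition diag_residual :: "int list" where
  "diag_residual = diag3 (add3 kernel_poly (add3 [[[- 365 * 2 ^ 53]]]
      (add3 (sos diag_free_rows diag_free_basis) (let P = sos diag_cap_rows diag_cap_basis
        in add3 (mul_term (1, 1, 0, 0) P) (mul_term (-1, 2, 0, 0) P)))))"

text \<open>Rounding has to be paid for in the final count: if the residuals are at most \<open>\<epsilon>\<close> and \<open>\<delta>\<close> in the
above units, then \<open>184\<close> points are impossible as long as \<open>182.5 + \<delta> < 183 (1 - \<epsilon>/2)\<close>.\<close>

lemma off_diag_residual_small: "norm3 off_diag_residual \<le> 60 * 2 ^ 40"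
  by code_simp

lemma diag_residual_small: "(\<Sum>c\<leftarrow>diag_residual. \<bar>c\<bar>) \<le> 10 * 2 ^ 40"
  by code_simp

section \<open>Evaluation of polynomials\<close>

lemma horner_ladd:
  assumes "\<And>a b. e (f a b) = e a + e b"
  shows "horner e x (ladd f p q) = horner e x p + horner e x q"
proof (induction p arbitrary: q)
  case (Cons a p)
  then show ?case by (cases q) (simp_all add: assms algebra_simps)
qed simp

lemma ev_add [simp]:
  "ev1 u (ladd (+) p q) = ev1 u p + ev1 u q"
  "ev2 u v (add2 P Q) = ev2 u v P + ev2 u v Q"
  "ev3 u v t (add3 A B) = ev3 u v t A + ev3 u v t B"
  by (simp_all add: horner_ladd)

lemma horner_pad: "e z = 0 \<Longrightarrow> horner e x (replicate k z @ p) = x ^ k * horner e x p"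
  by (induction k) (simp_all add: ac_simps)

lemma horner_map: "(\<And>a. e (g a) = c * e a) \<Longrightarrow> horner e x (map g p) = c * horner e x p"
  by (induction p) (simp_all add: algebra_simps)

fun ev_term :: "real \<Rightarrow> real \<Rightarrow> real \<Rightarrow> monom \<Rightarrow> real" where
  "ev_term u v t (c, a, b, k) = c * u ^ a * v ^ b * t ^ k"

abbreviation ev_elem :: "real \<Rightarrow> real \<Rightarrow> real \<Rightarrow> monom list \<Rightarrow> real" where
  "ev_elem u v t b \<equiv> (\<Sum>m\<leftarrow>b. ev_term u v t m)"

lemma ev_mul_term [simp]: "ev3 u v t (mul_term m P) = ev_term u v t m * ev3 u v t P"
proof (cases m)
  case (fields c a b k)
  have 1: "ev1 v (replicate b 0 @ map ((*) c) R) = (c * v ^ b) * ev1 v R" for R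
    by (simp add: horner_pad horner_map[where c = "real_of_int c"])
  have 2: "ev2 u v (replicate a [] @ map (\<lambda>R. replicate b 0 @ map ((*) c) R) Q) = (c * u ^ a * v ^ b) * ev2 u v Q" for Q
    by (subst horner_pad) (simp_all add: horner_map[where c = "c * v ^ b"] 1)
  show ?thesis
    unfolding fields mul_term.simps
    by (subst horner_pad) (simp_all add: horner_map[where c = "c * u ^ a * v ^ b"] 2)
qed

lemma ev_foldr_mul_term:
  "ev3 u v t (foldr (\<lambda>m. add3 (mul_term m P)) b A) = ev_elem u v t b * ev3 u v t P + ev3 u v t A"
  by (induction b) (simp_all add: algebra_simps)

fun dot :: "int list \<Rightarrow> real list \<Rightarrow> real" where
  "dot (x # xs) (b # bs) = x * b + dot xs bs"
| "dot _ _ = 0"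

fun form_val :: "int list list \<Rightarrow> real list \<Rightarrow> real" where
  "form_val (r # G) (b # bs) = b * dot r (b # bs) + form_val G bs"
| "form_val _ _ = 0"

lemma ev_lin_comb: "ev3 u v t (lin_comb w B) = dot w (map (ev_elem u v t) B)"
  by (induction w B rule: lin_comb.induct) (simp_all add: ev_foldr_mul_term)

lemma ev_form_poly: "ev3 u v t (form_poly G B) = form_val G (map (ev_elem u v t) B)"
  by (induction G B rule: form_poly.induct) (simp_all only: form_poly.simps ev_foldr_mul_term ev_lin_comb
      form_val.simps list.map horner.simps)

lemma dot_Nil2 [simp]: "dot w [] = 0" "form_val G [] = 0"
  by (cases w; simp) (cases G; simp)

lemma dot_ladd: "dot (ladd (+) r s) bs = dot r bs + dot s bs"
proof (induction r bs arbitrary: s rule: dot.induct)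
  case (1 x xs b bs)
  then show ?case by (cases s) (simp_all add: algebra_simps)
qed auto

lemma dot_map: "dot (map ((*) c) r) bs = c * dot r bs"
  by (induction r bs rule: dot.induct) (simp_all add: algebra_simps)

lemma form_val_add: "form_val (add2 G H) bs = form_val G bs + form_val H bs"
proof (induction G bs arbitrary: H rule: form_val.induct)
  case (1 r G b bs)
  then show ?case by (cases H) (simp_all add: dot_ladd algebra_simps)
qed auto

lemma form_val_sq_form: "form_val (sq_form w) bs = (dot w bs)\<^sup>2"
proof (induction w bs rule: dot.induct)
  case (1 x xs b bs)
  then show ?case by (simp add: dot_map power2_eq_square algebra_simps)
qed auto

lemma form_val_sum_sq_form_nonneg: "form_val (sum_sq_form W) bs \<ge> 0"
proof (induction W arbitrary: bs)
  case (Cons w W)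
  have "form_val ([] # sum_sq_form W) bs \<ge> 0"
    using Cons by (cases bs) auto
  then show ?case by (simp add: form_val_add form_val_sq_form)
qed auto

lemma ev_sos_nonneg: "ev3 u v t (sos W B) \<ge> 0"
  by (simp add: sos_def ev_form_poly form_val_sum_sq_form_nonneg)

lemma ev_outer: "ev2 u v (outer w) = ev1 u w * ev1 v w"
proof -
  have "ev2 u v (map (\<lambda>x. map ((*) x) w) w') = ev1 u w' * ev1 v w" for w'
    by (induction w') (simp_all add: horner_map[where c = "real_of_int _"] algebra_simps)
  then show ?thesis by simp
qed

lemma ev_gram_poly: "ev2 u v (gram_poly W) = (\<Sum>w\<leftarrow>W. ev1 u w * ev1 v w)"
  by (induction W) (simp_all add: gram_poly_def ev_outer del: outer.simps)

lemma ev_mul_w: "ev2 u v (mul_w P) = (1 - u\<^sup>2) * (1 - v\<^sup>2) * ev2 u v P"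
proof -
  have 1: "ev1 v (map uminus R) = (-1) * ev1 v R" for R by (rule horner_map) simp
  have 2: "ev2 u v (map (map uminus) Q) = (-1) * ev2 u v Q" for Q by (rule horner_map) (rule 1)
  have 3: "ev2 u v (map (\<lambda>R. 0 # 0 # map uminus R) Q) = (- v\<^sup>2) * ev2 u v Q" for Q
    by (rule horner_map) (simp add: 1 power2_eq_square)
  show ?thesis by (simp add: mul_w_def Let_def 2 3 power2_eq_square algebra_simps)
qed

lemma ev_gegen_poly:
  assumes w: "w = (1 - u\<^sup>2) * (1 - v\<^sup>2)"
  shows "ev3 u v s (gegen_poly m zs Q) = (\<Sum>j<length zs. zs ! j * w ^ j * s ^ (m - 2 * j)) * ev2 u v Q"
proof (induction m zs Q rule: gegen_poly.induct)
  case (2 m z zs Q)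
  have "ev2 u v (map (map ((*) z)) Q) = z * ev2 u v Q"
    by (rule horner_map, rule horner_map) simp
  moreover have "ev2 u v (mul_w Q) = w * ev2 u v Q"
    by (simp only: ev_mul_w w)
  ultimately show ?case
    by (simp add: 2 horner_pad sum.lessThan_Suc_shift sum_distrib_left
        sum_distrib_right algebra_simps del: sum.lessThan_Suc)
qed simp

lemma ev_subst_s: "ev3 u v t (subst_s P) = ev3 u v (t - u * v) P"
  by (induction P) (simp_all add: subst_s_def algebra_simps del: mul_term.simps)

lemma ev_diag2: "ev1 u (diag2 P) = ev2 u u P"
  by (induction P) simp_all

lemma ev_diag3: "ev1 u (diag3 P) = ev3 u u 1 P"
proof -
  have "ev2 u v (foldr add2 P []) = ev3 u v 1 P" for v by (induction P) simp_all
  then show ?thesis by (simp add: diag3_def ev_diag2)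
qed

lemma horner_bound:
  assumes "\<bar>x\<bar> \<le> 1" "\<And>a. \<bar>e a\<bar> \<le> n a"
  shows "\<bar>horner e x p\<bar> \<le> (\<Sum>a\<leftarrow>p. n a)"
proof (induction p)
  case (Cons a p)
  have "\<bar>x * horner e x p\<bar> \<le> \<bar>horner e x p\<bar>"
    using mult_right_mono[OF assms(1), of "\<bar>horner e x p\<bar>"] by (simp add: abs_mult)
  then show ?case using Cons assms(2)[of a] by simp
qed simp

lemma ev1_bound: "\<bar>u\<bar> \<le> 1 \<Longrightarrow> \<bar>ev1 u p\<bar> \<le> real_of_int (\<Sum>c\<leftarrow>p. \<bar>c\<bar>)"
  using horner_bound[of u real_of_int "\<lambda>c. \<bar>real_of_int c\<bar>" p]
  by (simp flip: of_int_abs sum_list_of_int add: comp_def)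

text \<open>The inequality that makes an inexact certificate useful: on the unit cube a polynomial is at most
the sum of the absolute values of its coefficients.\<close>

lemma ev3_bound:
  assumes "\<bar>u\<bar> \<le> 1" "\<bar>v\<bar> \<le> 1" "\<bar>t\<bar> \<le> 1"
  shows "\<bar>ev3 u v t P\<bar> \<le> real_of_int (norm3 P)"
proof -
  have "\<bar>ev2 u v Q\<bar> \<le> (\<Sum>R\<leftarrow>Q. real_of_int (\<Sum>c\<leftarrow>R. \<bar>c\<bar>))" for Q
    by (rule horner_bound[OF assms(1) ev1_bound[OF assms(2)]])
  then have "\<bar>ev3 u v t P\<bar> \<le> (\<Sum>Q\<leftarrow>P. \<Sum>R\<leftarrow>Q. real_of_int (\<Sum>c\<leftarrow>R. \<bar>c\<bar>))"
    by (rule horner_bound[OF assms(3)])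
  then show ?thesis by (simp add: norm3_def comp_def flip: sum_list_of_int)
qed

section \<open>Properties of the kernel\<close>

text \<open>The recursion of \<open>laplacian_zonal\<close> in dimension \<open>7\<close>.\<close>

fun legal_coeffs :: "nat \<Rightarrow> int list list \<Rightarrow> bool" where
  "legal_coeffs k [] = True"
| "legal_coeffs k (z # zs) \<longleftrightarrow> length z = Suc (k div 2) \<and> hd z > 0 \<and>
     (\<forall>j\<in>set [0..<k div 2]. 2 * (int j + 1) * (7 + 2 * int k - 2 * int j - 4) * z ! Suc j
        = - (int k - 2 * int j) * (int k - 2 * int j - 1) * z ! j) \<and> legal_coeffs (Suc k) zs"

text \<open>A weight \<open>w(u i) w(u j)\<close> can be absorbed into the coefficients of the points, so each summand is
positive definite by Schoenberg's theorem.\<close>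

lemma kernel_sum_positive_definite:
  fixes x :: "'a \<Rightarrow> real ^ 7" and u :: "'a \<Rightarrow> real"
  assumes "legal_coeffs k zs" and x: "\<And>i. i \<in> A \<Longrightarrow> x i \<bullet> x i = 1 - (u i)\<^sup>2"
  shows "(\<Sum>i\<in>A. \<Sum>j\<in>A. ev3 (u i) (u j) (x i \<bullet> x j) (kernel_sum k zs Ws)) \<ge> 0"
  using assms(1)
proof (induction k zs Ws rule: kernel_sum.induct)
  case (1 k z zs W Ws)
  define c where "c j = real_of_int (z ! j)" for j
  have len: "length z = Suc (k div 2)" and "hd z > 0" using 1(2) by auto
  then have c0: "c 0 > 0" by (cases z) (auto simp: c_def)
  have c: "2 * (real j + 1) * (real CARD(7) + 2 * k - 2 * j - 4) * c (Suc j)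
      = - (real k - 2 * j) * (real k - 2 * j - 1) * c j" if "2 * j + 2 \<le> k" for j
  proof -
    have "j \<in> set [0..<k div 2]" using that by auto
    then have "2 * (int j + 1) * (7 + 2 * int k - 2 * int j - 4) * z ! Suc j
        = - (int k - 2 * int j) * (int k - 2 * int j - 1) * z ! j" using 1(2) by simp
    from arg_cong[OF this, of real_of_int] show ?thesis by (simp add: c_def)
  qed
  have *: "ev3 (u i) (u j) (x i \<bullet> x j) (gegen_poly k z (gram_poly W))
      = (\<Sum>w\<leftarrow>W. ev1 (u i) w * ev1 (u j) w * gegen c k (x i \<bullet> x j) ((x i \<bullet> x i) * (x j \<bullet> x j)))"
    if "i \<in> A" "j \<in> A" for i j
    using that by (simp add: ev_gegen_poly[OF refl] ev_gram_poly gegen_def len lessThan_Suc_atMost x c_def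
        sum_list_mult_const mult.commute)
  have "(\<Sum>i\<in>A. \<Sum>j\<in>A. ev3 (u i) (u j) (x i \<bullet> x j) (gegen_poly k z (gram_poly W)))
      = (\<Sum>i\<in>A. \<Sum>j\<in>A. \<Sum>w\<leftarrow>W. ev1 (u i) w * ev1 (u j) w * gegen c k (x i \<bullet> x j) ((x i \<bullet> x i) * (x j \<bullet> x j)))"
    by (intro sum.cong refl *)
  also have "\<dots> = (\<Sum>w\<leftarrow>W. \<Sum>i\<in>A. \<Sum>j\<in>A. ev1 (u i) w * ev1 (u j) w * gegen c k (x i \<bullet> x j) ((x i \<bullet> x i) * (x j \<bullet> x j)))"
    by (induction W) (simp_all add: sum.distrib)
  also have "\<dots> \<ge> 0"
    by (intro sum_list_nonneg) (auto intro!: gegen_positive_definite[OF c c0])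
  finally show ?case using 1 by (simp add: sum.distrib)
qed simp_all

text \<open>A unit vector with coordinate \<open>u i\<close> along the pole has a projection \<open>x i\<close> to the equatorial
hyperplane of squared length \<open>1 - (u i)\<^sup>2\<close>; \<open>x i \<bullet> x j + u i * u j\<close> is the inner product of the unit
vectors themselves.\<close>

lemma kernel_positive_definite:
  fixes x :: "'a \<Rightarrow> real ^ 7" and u :: "'a \<Rightarrow> real"
  assumes "\<And>i. i \<in> A \<Longrightarrow> x i \<bullet> x i = 1 - (u i)\<^sup>2"
  shows "(\<Sum>i\<in>A. \<Sum>j\<in>A. ev3 (u i) (u j) (x i \<bullet> x j + u i * u j) kernel_poly) \<ge> 0"
proof -
  have "legal_coeffs 0 gegen_coeffs" by code_simp
  from kernel_sum_positive_definite[OF this assms, where Ws = kernel_rows]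
  show ?thesis by (simp add: kernel_poly_def ev_subst_s)
qed

lemma kernel_off_diagonal:
  assumes u: "0 \<le> u" "u \<le> 1" and v: "0 \<le> v" "v \<le> 1" and t: "-1 \<le> t" "t \<le> 1 / 2"
  shows "ev3 u v t kernel_poly \<le> 30 * 2 ^ 40 - 2 ^ 54"
proof -
  have equator: "ev3 u v t equator_poly \<ge> 0"
  proof -
    let ?P = "ev3 u v t (sos equator_rows equator_basis)"
    let ?Q = "ev3 u v t (sos equator_rows (map (map swap_term) equator_basis))"
    have "ev3 u v t equator_poly = u * (1 - u) * ?P + v * (1 - v) * ?Q"
      by (simp add: equator_poly_def Let_def power2_eq_square algebra_simps del: mul_term.simps)
    then show ?thesis using u v by (simp add: ev_sos_nonneg)
  qed
  have code: "ev3 u v t code_poly \<ge> 0"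
  proof -
    let ?P = "ev3 u v t (add3 (sos code_sym_rows code_sym_basis) (sos code_anti_rows code_anti_basis))"
    have "ev3 u v t code_poly = (1 + t) * (1 - 2 * t) * ?P"
      by (simp add: code_poly_def Let_def power2_eq_square algebra_simps del: mul_term.simps)
    moreover have "?P \<ge> 0" by (simp add: ev_sos_nonneg)
    ultimately show ?thesis using t by simp
  qed
  have eq: "ev3 u v t off_diag_residual = 2 * (ev3 u v t kernel_poly + 2 ^ 54
      + ev3 u v t (sos free_sym_rows free_sym_basis) + ev3 u v t (sos free_anti_rows free_anti_basis))
      + ev3 u v t equator_poly + ev3 u v t code_poly"
    by (simp add: off_diag_residual_def del: mul_term.simps)
  have le: "ev3 u v t off_diag_residual \<le> 60 * 2 ^ 40"
  proof -
    have "\<bar>ev3 u v t off_diag_residual\<bar> \<le> real_of_int (norm3 off_diag_residual)"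
      using u v t by (intro ev3_bound) auto
    also have "\<dots> \<le> real_of_int (60 * 2 ^ 40)"
      using off_diag_residual_small by (rule of_int_le_iff[THEN iffD2])
    finally show ?thesis by simp
  qed
  have "K \<le> 30 * a - b"
    if "r = 2 * (K + b + f + g) + h + c" "r \<le> 60 * a" "h \<ge> 0" "c \<ge> 0" "f \<ge> 0" "g \<ge> 0"
    for K a b r c f g h :: real
    using that by (simp add: algebra_simps)
  from this[OF eq le equator code ev_sos_nonneg ev_sos_nonneg] show ?thesis .
qed

lemma kernel_diagonal:
  assumes u: "0 \<le> u" "u \<le> 1"
  shows "ev3 u u 1 kernel_poly \<le> 365 * 2 ^ 53 + 10 * 2 ^ 40"
proof -
  let ?P = "ev3 u u 1 (sos diag_cap_rows diag_cap_basis)"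
  have "ev1 u diag_residual = ev3 u u 1 kernel_poly - 365 * 2 ^ 53
      + ev3 u u 1 (sos diag_free_rows diag_free_basis) + u * (1 - u) * ?P"
    by (simp add: diag_residual_def ev_diag3 Let_def power2_eq_square algebra_simps del: mul_term.simps)
  moreover have "u * (1 - u) * ?P \<ge> 0" using u by (simp add: ev_sos_nonneg)
  moreover have "ev1 u diag_residual \<le> 10 * 2 ^ 40"
  proof -
    have "\<bar>ev1 u diag_residual\<bar> \<le> real_of_int (\<Sum>c\<leftarrow>diag_residual. \<bar>c\<bar>)"
      using u by (intro ev1_bound) auto
    also have "\<dots> \<le> real_of_int (10 * 2 ^ 40)"
      using diag_residual_small by (rule of_int_le_iff[THEN iffD2])
    finally show ?thesis by simp
  qed
  ultimately show ?thesis
    using ev_sos_nonneg[of u u 1 diag_free_rows diag_free_basis] by linarith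
qed

section \<open>The upper bound\<close>

lemma card_configuration_le:
  fixes a :: 8
  assumes C: "one_sided_kissing_configuration (axis a 1) C"
  shows "card C \<le> 183"
proof (rule ccontr)
  assume "\<not> card C \<le> 183"
  then have n: "card C \<ge> 184" by simp
  have fin: "finite C" and unit: "\<And>x. x \<in> C \<Longrightarrow> x \<bullet> x = 1" and pole: "\<And>x. x \<in> C \<Longrightarrow> 0 \<le> x $ a"
    and apart: "\<And>x y. x \<in> C \<Longrightarrow> y \<in> C \<Longrightarrow> x \<noteq> y \<Longrightarrow> x \<bullet> y \<le> 1 / 2"
    using C by (auto simp: one_sided_kissing_configuration_iff inner_axis')
  have norm: "norm x = 1" if "x \<in> C" for x
    using unit[OF that] by (simp add: norm_eq_sqrt_inner)
  have le1: "x $ a \<le> 1" if "x \<in> C" for x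
    using component_le_norm_cart[of x a] norm[OF that] by simp
  \<comment> \<open>The equatorial hyperplane has to be a space of dimension \<open>7\<close>: in dimension \<open>8\<close> the Gegenbauer
    polynomials of the certificate would belong to the wrong parameter.\<close>
  have "card (UNIV :: 7 set) = card (- {a})"
    by (simp add: Compl_eq_Diff_UNIV card_Diff_singleton)
  then obtain h :: "7 \<Rightarrow> 8" where h: "bij_betw h UNIV (- {a})"
    using finite_same_card_bij[of "UNIV :: 7 set" "- {a}"] by auto
  define P :: "real ^ 8 \<Rightarrow> real ^ 7" where "P x = (\<chi> i. x $ h i)" for x
  have P: "P x \<bullet> P y = x \<bullet> y - x $ a * y $ a" for x y
  proof -
    have "x \<bullet> y = x $ a * y $ a + (\<Sum>i\<in>- {a}. x $ i * y $ i)"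
      by (simp add: inner_vec_def sum.remove[of UNIV a] Compl_eq_Diff_UNIV)
    also have "(\<Sum>i\<in>- {a}. x $ i * y $ i) = P x \<bullet> P y"
      by (simp add: P_def inner_vec_def sum.reindex_bij_betw[OF h, of "\<lambda>i. x $ i * y $ i"])
    finally show ?thesis by simp
  qed
  define K where "K x y = ev3 (x $ a) (y $ a) (x \<bullet> y) kernel_poly" for x y :: "real ^ 8"
  define d s :: real where "d = 365 * 2 ^ 53 + 10 * 2 ^ 40" and "s = 2 ^ 54 - 30 * 2 ^ 40"
  have "0 \<le> (\<Sum>x\<in>C. \<Sum>y\<in>C. K x y)"
    using kernel_positive_definite[of C P "\<lambda>x. x $ a"] unit by (simp add: P K_def power2_eq_square)
  also have "\<dots> \<le> (\<Sum>x\<in>C. d - 183 * s)"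
    \<comment> \<open>Each further point lowers the row sum, because \<open>s\<close> is positive; the \<open>183\<close> guaranteed ones
      already make it negative.\<close>
  proof (rule sum_mono)
    fix x assume x: "x \<in> C"
    have off: "K x y \<le> - s" if "y \<in> C - {x}" for y
    proof -
      have y: "y \<in> C" "y \<noteq> x" using that by auto
      have "\<bar>x \<bullet> y\<bar> \<le> 1"
        using Cauchy_Schwarz_ineq2[of x y] norm x y by simp
      then show ?thesis
        using kernel_off_diagonal[of "x $ a" "y $ a" "x \<bullet> y"] pole le1 apart[of x y] x y
        by (simp add: K_def s_def)
    qed
    have "(\<Sum>y\<in>C. K x y) = K x x + (\<Sum>y\<in>C - {x}. K x y)"
      using fin x by (rule sum.remove)
    also have "K x x \<le> d"
      using kernel_diagonal[of "x $ a"] pole[OF x] le1[OF x] unit[OF x] by (simp add: K_def d_def)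
    also have "(\<Sum>y\<in>C - {x}. K x y) \<le> (\<Sum>y\<in>C - {x}. - s)"
      by (intro sum_mono off)
    also have "\<dots> = - (real (card C - 1) * s)"
      using x by (simp add: card_Diff_singleton)
    also have "\<dots> \<le> - (183 * s)"
    proof -
      have "183 * s \<le> real (card C - 1) * s"
        using n by (intro mult_right_mono) (auto simp: s_def)
      then show ?thesis by simp
    qed
    finally show "(\<Sum>y\<in>C. K x y) \<le> d - 183 * s" by simp
  qed
  also have "\<dots> < 0"
    using n by (simp add: d_def s_def mult_pos_neg)
  finally show False by simp
qed

section \<open>Half of the \<open>E\<^sub>8\<close> root system\<close>

text \<open>The roots of \<open>E\<^sub>8\<close> are taken from the extended Hamming code: in the scaling with squared length \<open>4\<close>
they are the \<open>16\<close> vectors \<open>\<plusminus>2 e\<^sub>i\<close> and the \<open>14 * 16\<close> vectors with entries \<open>\<plusminus>1\<close> on the support of a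
word of weight \<open>4\<close>. The pole \<open>e\<^sub>0\<close> is a root itself. It is orthogonal to \<open>126\<close> roots, has inner
product \<open>1/2\<close> with \<open>56\<close> normalized roots, and this leaves \<open>126 + 56 + 1 = 183\<close> in the closed half.\<close>

fun int_dot :: "int list \<Rightarrow> int list \<Rightarrow> int" where
  "int_dot (x # xs) (y # ys) = x * y + int_dot xs ys"
| "int_dot _ _ = 0"

fun signings :: "int list \<Rightarrow> int list list" where
  "signings [] = [[]]"
| "signings (x # xs) =
     (if x = 0 then map ((#) 0) (signings xs) else map ((#) x) (signings xs) @ map ((#) (- x)) (signings xs))"

definition hamming_words :: "int list list" where
  "hamming_words =
    [[0,0,0,0,1,1,1,1], [0,0,1,1,0,0,1,1],
     [0,0,1,1,1,1,0,0], [0,1,0,1,0,1,0,1],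
     [0,1,0,1,1,0,1,0], [0,1,1,0,0,1,1,0],
     [0,1,1,0,1,0,0,1], [1,0,0,1,0,1,1,0],
     [1,0,0,1,1,0,0,1], [1,0,1,0,0,1,0,1],
     [1,0,1,0,1,0,1,0], [1,1,0,0,0,0,1,1],
     [1,1,0,0,1,1,0,0], [1,1,1,1,0,0,0,0]]"

definition half_roots :: "int list list" where
  "half_roots = filter (\<lambda>l. hd l \<ge> 0)
     (concat (map signings (map (\<lambda>i. (replicate 8 0)[i := 2]) [0..<8] @ hamming_words)))"

lemma half_roots_distinct: "distinct half_roots" "length half_roots = 183"
  by code_simp+

lemma half_roots_mod_2:
  "\<forall>l\<in>set half_roots. length l = 8 \<and> hd l \<ge> 0 \<and> int_dot l l = 4
     \<and> map (\<lambda>x. x mod 2) l \<in> set (replicate 8 0 # hamming_words)"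
  by code_simp

text \<open>Since the code is self-orthogonal, inner products of roots are even: they depend modulo \<open>2\<close> only on the
code words. Distinct roots have inner product less than \<open>4\<close>, hence at most \<open>2\<close>, without any
inspection of pairs of roots.\<close>

lemma hamming_self_orthogonal:
  "\<forall>a\<in>set (replicate 8 0 # hamming_words). \<forall>b\<in>set (replicate 8 0 # hamming_words). even (int_dot a b)"
  by code_simp

lemma even_int_dot_mod_2: "even (int_dot (map (\<lambda>x. x mod 2) xs) (map (\<lambda>x. x mod 2) ys)) \<longleftrightarrow> even (int_dot xs ys)"
  by (induction xs ys rule: int_dot.induct) auto

lemma half_roots_even:
  assumes "l \<in> set half_roots" "m \<in> set half_roots"
  shows "even (int_dot l m)"
  using assms half_roots_mod_2 hamming_self_orthogonal even_int_dot_mod_2 by blast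

lemma int_dot_eq_sum: "length xs = length ys \<Longrightarrow> int_dot xs ys = (\<Sum>i<length xs. xs ! i * ys ! i)"
  by (induction xs ys rule: list_induct2) (simp_all add: sum.lessThan_Suc_shift del: sum.lessThan_Suc)

lemma half_root_configuration:
  obtains a :: 8 and C where "one_sided_kissing_configuration (axis a 1) C" "card C = 183"
proof -
  \<comment> \<open>An enumeration of the index type, to read integer lists as vectors.\<close>
  obtain g :: "nat \<Rightarrow> 8" where g: "bij_betw g {..<8} UNIV"
    using ex_bij_betw_nat_finite[of "UNIV :: 8 set"] by (auto simp: atLeast0LessThan)
  define f where "f = inv_into {..<8} g"
  have fg: "f (g i) = i" if "i < 8" for i
    using g that by (simp add: f_def bij_betw_def inv_into_f_f)
  define V :: "int list \<Rightarrow> real ^ 8" where "V l = (\<chi> i. real_of_int (l ! f i) / 2)" for l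
  have Vg: "V l $ g i = real_of_int (l ! i) / 2" if "i < 8" for l i
    using that by (simp add: V_def fg)
  have dot: "V l \<bullet> V m = real_of_int (int_dot l m) / 4" if "length l = 8" "length m = 8" for l m
  proof -
    have "V l \<bullet> V m = (\<Sum>i<8. V l $ g i * V m $ g i)"
      by (simp add: inner_vec_def sum.reindex_bij_betw[OF g, of "\<lambda>i. V l $ i * V m $ i"])
    also have "\<dots> = (\<Sum>i<8. real_of_int (l ! i * m ! i) / 4)"
      by (intro sum.cong refl) (simp add: Vg)
    also have "\<dots> = real_of_int (int_dot l m) / 4"
      using that by (simp add: int_dot_eq_sum sum_divide_distrib)
    finally show ?thesis .
  qed
  let ?L = "set half_roots"
  have len: "length l = 8" and unit: "V l \<bullet> V l = 1" and pole: "V l $ g 0 \<ge> 0" if "l \<in> ?L" for l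
  proof -
    show "length l = 8" using that half_roots_mod_2 by blast
    then have "hd l = l ! 0" by (cases l) auto
    then show "V l \<bullet> V l = 1" "V l $ g 0 \<ge> 0"
      using that half_roots_mod_2 dot[of l l] by (auto simp: Vg)
  qed
  have inj: "inj_on V ?L"
  proof (rule inj_onI)
    fix l m assume lm: "l \<in> ?L" "m \<in> ?L" "V l = V m"
    have "l ! i = m ! i" if "i < 8" for i
      using Vg[OF that, of l] Vg[OF that, of m] lm(3) by simp
    then show "l = m" using len lm(1,2) by (intro nth_equalityI) auto
  qed
  have apart: "V l \<bullet> V m \<le> 1 / 2" if "l \<in> ?L" "m \<in> ?L" "V l \<noteq> V m" for l m
  proof -
    have "0 < (V l - V m) \<bullet> (V l - V m)" using that(3) by simp
    also have "\<dots> = 2 - 2 * (V l \<bullet> V m)"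
      using unit[OF that(1)] unit[OF that(2)] by (simp add: inner_diff inner_commute)
    finally have "int_dot l m < 4" using dot[of l m] len that by simp
    with half_roots_even[OF that(1,2)] have "int_dot l m \<le> 2" by presburger
    then show ?thesis using dot[of l m] len that by simp
  qed
  show ?thesis
  proof
    show "one_sided_kissing_configuration (axis (g 0) 1) (V ` ?L)"
      unfolding one_sided_kissing_configuration_iff
      using unit pole apart by (auto simp: inner_axis')
    show "card (V ` ?L) = 183"
      using inj half_roots_distinct by (simp add: card_image distinct_card)
  qed
qed

text \<open>All unit poles give the same number, so it can be computed at the coordinate pole of the
root configuration.\<close>

theorem mainTheorem3:
  fixes e :: "real ^ 8"
  assumes "norm e = 1"
  shows "one_sided_kissing_number e = 183"
proof -
  obtain a :: 8 and C where C: "one_sided_kissing_configuration (axis a 1) C" "card C = 183"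
    by (rule half_root_configuration)
  have "one_sided_kissing_number (axis a 1 :: real ^ 8) = 183"
    unfolding one_sided_kissing_number_def
  proof (rule Max_eqI)
    show "finite {card C |C. one_sided_kissing_configuration (axis a 1) C}"
      by (rule finite_one_sided_kissing_cards)
    show "y \<le> 183" if "y \<in> {card C |C. one_sided_kissing_configuration (axis a 1) C}" for y
      using that card_configuration_le[of a] by auto
    show "183 \<in> {card C |C. one_sided_kissing_configuration (axis a 1) C}"
      using C by (intro CollectI exI[of _ C]) simp
  qed
  then show ?thesis
    using one_sided_kissing_number_cong[OF assms, of "axis a 1"] by simp
qed

end
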